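(* Let $G=(N,(n_i)_{i\in[N]})$ be a multi-unit game with $N\ge 3$ players and total number of facilities $n=\sum_{i=1}^N n_i\ge 4$. Then $G$ has a pure Nash equilibrium if and only if it has no dominant player.
   Context: Multi-unit game $G=(N,(n_i)_{i\in[N]})$: customers are uniformly distributed on $[0,1]$; $[N]=\{1,\dots,N\}$ is the set of players; $n_1\le\dots\le n_N$ are positive integers. The pure strategy set of player $i$ is $S_i=\{(s_i^1,\dots,s_i^{n_i})\in[0,1]^{n_i}: s_i^1<\dots<s_i^{n_i}\}$; a pure strategy is identified with the set of its coordinates (player $i$'s facilities). For a pure profile $\mathbf s=(s_1,\dots,s_N)$ let $\mathcal L(\mathbf s)=\bigcup_i s_i$, $d(t,A)=\min_{f\in A}|t-f|$, and $r_t(\mathbf s)=\{i\in[N]: d(t,s_i)\le d(t,\mathcal L(\mathbf s))\}$. The payoff is $u_i(\mathbf s)=\int_0^1\frac{\mathbf 1[i\in r_t(\mathbf s)]}{|r_t(\mathbf s)|}\,dt$. A pure profile is a pure Nash equilibrium if no player can strictly increase her payoff by a unilateral change of pure strategy. Player $N$ is called a dominant player if $\sum_{i=1}^{N-1}n_i<n_N$; the game has a dominant player if player $N$ is dominant. *)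

theory Defs
  imports "HOL-Analysis.Analysis"
begin

text \<open>
  A game is given by the number \<open>N\<close> of players, who are named \<open>1, \<dots>, N\<close>, and by
  \<open>n :: nat \<Rightarrow> nat\<close>, where \<open>n i\<close> is the number of facilities of player \<open>i\<close>. Only the values
  of \<open>n\<close>, and of strategy profiles, on \<open>{1..N}\<close> matter.
\<close>

definition multi_unit_game :: "nat \<Rightarrow> (nat \<Rightarrow> nat) \<Rightarrow> bool" where
  "multi_unit_game N n \<longleftrightarrow> (\<forall>i\<in>{1..N}. 0 < n i) \<and> mono_on {1..N} n"

definition pure_strategies :: "nat \<Rightarrow> real list set" where
  "pure_strategies m = {x. length x = m \<and> set x \<subseteq> {0..1} \<and> sorted_wrt (<) x}"

definition pure_profile :: "nat \<Rightarrow> (nat \<Rightarrow> nat) \<Rightarrow> (nat \<Rightarrow> real list) \<Rightarrow> bool" where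
  "pure_profile N n s \<longleftrightarrow> (\<forall>i\<in>{1..N}. s i \<in> pure_strategies (n i))"

definition locations :: "nat \<Rightarrow> (nat \<Rightarrow> real list) \<Rightarrow> real set" where
  "locations N s = (\<Union>i\<in>{1..N}. set (s i))"

text \<open>Only used for finite nonempty \<open>A\<close>; \<open>Min\<close> is unspecified otherwise.\<close>

definition distance :: "real \<Rightarrow> real set \<Rightarrow> real" where
  "distance t A = Min ((\<lambda>f. \<bar>t - f\<bar>) ` A)"

definition closest_players :: "nat \<Rightarrow> (nat \<Rightarrow> real list) \<Rightarrow> real \<Rightarrow> nat set" where
  "closest_players N s t =
    {i \<in> {1..N}. distance t (set (s i)) \<le> distance t (locations N s)}"

definition payoff :: "nat \<Rightarrow> (nat \<Rightarrow> real list) \<Rightarrow> nat \<Rightarrow> real" where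
  "payoff N s i =
    integral {0..1} (\<lambda>t. of_bool (i \<in> closest_players N s t) / real (card (closest_players N s t)))"

definition pure_Nash_equilibrium :: "nat \<Rightarrow> (nat \<Rightarrow> nat) \<Rightarrow> (nat \<Rightarrow> real list) \<Rightarrow> bool" where
  "pure_Nash_equilibrium N n s \<longleftrightarrow>
    pure_profile N n s \<and>
    (\<forall>i\<in>{1..N}. \<forall>x\<in>pure_strategies (n i). \<not> payoff N s i < payoff N (s(i := x)) i)"

definition has_dominant_player :: "nat \<Rightarrow> (nat \<Rightarrow> nat) \<Rightarrow> bool" where
  "has_dominant_player N n \<longleftrightarrow> (\<Sum>i=1..N - 1. n i) < n N"

end

theory Submission
  imports Defs
begin

text \<open>
  A profile is an equilibrium as soon as there are prices \<open>c i\<close> with \<open>\<Sum>i. n i * c i = 1\<close> such that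
  every customer is within distance \<open>c i\<close> of a rival of player \<open>i\<close>: against such rivals one facility
  earns at most \<open>c i\<close>, and since payoffs add up to 1, these bounds are attained. If the number of
  facilities is even, put two different owners on each point of a uniform grid. If it is odd,
  let player 1 (the smallest, with \<open>m\<close> facilities) be alone on \<open>m\<close> consecutive inner grid points, put two
  different owners among the others on each remaining grid point, and let \<open>m - 1\<close> further facilities of the
  others cut the block of player 1 into \<open>m\<close> equal parts.

  Conversely, let \<open>F\<close> be the set of rival locations of a dominant player. In an equilibrium this player
  earns at least the supremum obtained by placing her facilities next to points of \<open>F\<close>. Her actual payoff is
  at most the mean of what she would get by moving her facilities on \<open>F\<close> infinitesimally to the right,
  respectively to the left. Both values are at most that supremum, and since she has more than
  \<open>card F\<close> facilities, the pigeonhole principle makes one of the two inequalities strict.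
\<close>

section \<open>Payoffs as integrals of shares\<close>

text \<open>\<open>F\<close> stands for the rivals' facilities and \<open>X\<close> for the player's
  own. With bare sets, ties among own facilities disappear from view and a deviation changes
  \<open>X\<close> only.\<close>

definition wins :: "real set \<Rightarrow> real set \<Rightarrow> real \<Rightarrow> bool" where
  "wins F X t \<longleftrightarrow> (\<exists>x\<in>X. \<forall>f\<in>F. \<bar>t - x\<bar> < \<bar>t - f\<bar>)"

definition reaches :: "real set \<Rightarrow> real set \<Rightarrow> real \<Rightarrow> bool" where
  "reaches F X t \<longleftrightarrow> (\<exists>x\<in>X. \<forall>f\<in>F. \<bar>t - x\<bar> \<le> \<bar>t - f\<bar>)"

definition rival_locations :: "nat \<Rightarrow> (nat \<Rightarrow> real list) \<Rightarrow> nat \<Rightarrow> real set" where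
  "rival_locations N s i = (\<Union>j\<in>{1..N} - {i}. set (s j))"

definition share :: "nat \<Rightarrow> (nat \<Rightarrow> real list) \<Rightarrow> nat \<Rightarrow> real \<Rightarrow> real" where
  "share N s i t = of_bool (i \<in> closest_players N s t) / real (card (closest_players N s t))"

lemma payoff_eq_integral_share: "payoff N s i = integral {0..1} (share N s i)"
  unfolding payoff_def share_def ..

lemma distance_le_distance_iff:
  assumes "finite A" "A \<noteq> {}" "finite B" "B \<noteq> {}"
  shows "distance t A \<le> distance t B \<longleftrightarrow> (\<exists>a\<in>A. \<forall>b\<in>B. \<bar>t - a\<bar> \<le> \<bar>t - b\<bar>)"
proof -
  have "distance t A \<le> distance t B \<longleftrightarrow> (\<exists>a\<in>A. \<bar>t - a\<bar> \<le> distance t B)"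
    unfolding distance_def[of t A] using assms(1,2) by (subst Min_le_iff) auto
  also have "\<dots> \<longleftrightarrow> (\<exists>a\<in>A. \<forall>b\<in>B. \<bar>t - a\<bar> \<le> \<bar>t - b\<bar>)"
    unfolding distance_def using assms(3,4) by (subst Min_ge_iff) auto
  finally show ?thesis .
qed

lemma finite_locations [simp]: "finite (locations N s)"
  by (simp add: locations_def)

lemma finite_rival_locations [simp]: "finite (rival_locations N s i)"
  by (simp add: rival_locations_def)

lemma finite_closest_players [simp]: "finite (closest_players N s t)"
  by (simp add: closest_players_def)

lemma rival_locations_fun_upd [simp]: "rival_locations N (s(i := x)) i = rival_locations N s i"
  by (auto simp: rival_locations_def)

lemma locations_eq_rival_locations_Un:
  assumes "i \<in> {1..N}"
  shows "locations N s = rival_locations N s i \<union> set (s i)"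
  using assms by (auto simp: locations_def rival_locations_def)

lemma in_closest_players_iff:
  assumes "\<forall>j\<in>{1..N}. s j \<noteq> []" "i \<in> {1..N}"
  shows "i \<in> closest_players N s t \<longleftrightarrow> (\<exists>x\<in>set (s i). \<forall>f\<in>locations N s. \<bar>t - x\<bar> \<le> \<bar>t - f\<bar>)"
proof -
  have "locations N s \<noteq> {}"
    using assms by (auto simp: locations_def)
  then show ?thesis
    using assms by (auto simp: closest_players_def distance_le_distance_iff)
qed

lemma ex_closest_point:
  fixes t :: real
  assumes "finite A" "A \<noteq> {}"
  shows "\<exists>a\<in>A. \<forall>b\<in>A. \<bar>t - a\<bar> \<le> \<bar>t - b\<bar>"
  using ex_is_arg_min_if_finite[OF assms, of "\<lambda>a. \<bar>t - a\<bar>"]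
  by (auto simp: is_arg_min_linorder)

lemma closest_players_nonempty:
  assumes "\<forall>j\<in>{1..N}. s j \<noteq> []" "1 \<le> N"
  shows "closest_players N s t \<noteq> {}"
proof -
  have "locations N s \<noteq> {}"
    using assms by (auto simp: locations_def)
  then obtain a where a: "a \<in> locations N s" "\<forall>b\<in>locations N s. \<bar>t - a\<bar> \<le> \<bar>t - b\<bar>"
    using ex_closest_point[of "locations N s" t] by auto
  then obtain j where "j \<in> {1..N}" "a \<in> set (s j)"
    by (auto simp: locations_def)
  then show ?thesis
    using a in_closest_players_iff[OF assms(1)] by blast
qed

text \<open>Only the comparison with rivals matters: if some own facility is at least as near as all
  rivals, then the own facility nearest to \<open>t\<close> is nearest among all locations.\<close>

lemma in_closest_players_iff_reaches:
  assumes "\<forall>j\<in>{1..N}. s j \<noteq> []" "i \<in> {1..N}"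
  shows "i \<in> closest_players N s t \<longleftrightarrow> reaches (rival_locations N s i) (set (s i)) t"
proof
  assume "i \<in> closest_players N s t"
  then show "reaches (rival_locations N s i) (set (s i)) t"
    using assms by (auto simp: in_closest_players_iff reaches_def locations_eq_rival_locations_Un)
next
  assume "reaches (rival_locations N s i) (set (s i)) t"
  then obtain x where x: "x \<in> set (s i)" "\<forall>f\<in>rival_locations N s i. \<bar>t - x\<bar> \<le> \<bar>t - f\<bar>"
    by (auto simp: reaches_def)
  obtain y where y: "y \<in> set (s i)" "\<forall>b\<in>set (s i). \<bar>t - y\<bar> \<le> \<bar>t - b\<bar>"
    using ex_closest_point[of "set (s i)" t] x by (metis List.finite_set empty_iff)
  have "\<bar>t - y\<bar> \<le> \<bar>t - f\<bar>" if "f \<in> locations N s" for f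
    using that x y locations_eq_rival_locations_Un[OF assms(2)] order_trans by blast
  then show "i \<in> closest_players N s t"
    using y assms by (auto simp: in_closest_players_iff)
qed

lemma share_nonneg: "0 \<le> share N s i t"
  by (simp add: share_def)

lemma share_le_1: "share N s i t \<le> 1"
proof (cases "i \<in> closest_players N s t")
  case True
  then have "1 \<le> card (closest_players N s t)"
    by (metis One_nat_def Suc_leI card_gt_0_iff empty_iff finite_closest_players)
  then show ?thesis by (simp add: share_def divide_simps)
qed (simp add: share_def)

lemma share_eq_1:
  assumes "\<forall>j\<in>{1..N}. s j \<noteq> []" "i \<in> {1..N}"
    and "wins (rival_locations N s i) (set (s i)) t"
  shows "share N s i t = 1"
proof -
  obtain x where x: "x \<in> set (s i)" "\<forall>f\<in>rival_locations N s i. \<bar>t - x\<bar> < \<bar>t - f\<bar>"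
    using assms(3) by (auto simp: wins_def)
  have "i \<in> closest_players N s t"
    unfolding in_closest_players_iff_reaches[OF assms(1,2)] reaches_def using x by force
  moreover have "j \<notin> closest_players N s t" if "j \<noteq> i" for j
  proof
    assume j: "j \<in> closest_players N s t"
    then have jN: "j \<in> {1..N}" by (simp add: closest_players_def)
    then obtain y where y: "y \<in> set (s j)" "\<forall>f\<in>locations N s. \<bar>t - y\<bar> \<le> \<bar>t - f\<bar>"
      using j in_closest_players_iff[OF assms(1)] by blast
    have "y \<in> rival_locations N s i" "x \<in> locations N s"
      using y x jN that assms(2) by (auto simp: rival_locations_def locations_def)
    then show False using x y by force
  qed
  ultimately have "closest_players N s t = {i}" by auto
  then show ?thesis by (simp add: share_def)
qed

text \<open>If the player is closest without winning outright, some rival facility is just as near,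
  and its owner is then closest too.\<close>

lemma share_le_half:
  assumes "\<forall>j\<in>{1..N}. s j \<noteq> []" "i \<in> {1..N}" "2 \<le> N"
    and "\<not> wins (rival_locations N s i) (set (s i)) t"
  shows "share N s i t \<le> 1 / 2"
proof (cases "i \<in> closest_players N s t")
  case True
  then obtain x where x: "x \<in> set (s i)" "\<forall>f\<in>locations N s. \<bar>t - x\<bar> \<le> \<bar>t - f\<bar>"
    using in_closest_players_iff[OF assms(1,2)] by blast
  then obtain f where f: "f \<in> rival_locations N s i" "\<bar>t - f\<bar> \<le> \<bar>t - x\<bar>"
    using assms(4) by (force simp: wins_def)
  then obtain j where j: "j \<in> {1..N}" "j \<noteq> i" "f \<in> set (s j)"
    unfolding rival_locations_def by blast
  have "j \<in> closest_players N s t"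
    unfolding in_closest_players_iff[OF assms(1) j(1)] using j(3) x(2) f(2) order_trans by blast
  then have "card {i, j} \<le> card (closest_players N s t)"
    using True by (intro card_mono) auto
  then have "2 \<le> card (closest_players N s t)"
    using j by auto
  then show ?thesis by (simp add: share_def divide_simps)
qed (simp add: share_def)

lemma share_eq_0:
  assumes "\<forall>j\<in>{1..N}. s j \<noteq> []" "i \<in> {1..N}"
    and "\<not> reaches (rival_locations N s i) (set (s i)) t"
  shows "share N s i t = 0"
  using assms in_closest_players_iff_reaches by (simp add: share_def)

lemma closed_reaches: "finite X \<Longrightarrow> closed {t. reaches F X t}"
proof -
  assume "finite X"
  moreover have "{t. reaches F X t} = (\<Union>x\<in>X. \<Inter>f\<in>F. {t. \<bar>t - x\<bar> \<le> \<bar>t - f\<bar>})"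
    by (auto simp: reaches_def)
  ultimately show ?thesis
    by (auto intro!: closed_UN closed_INT closed_Collect_le continuous_intros)
qed

text \<open>The share is an indicator of a closed set divided by a sum of such indicators, hence
  Borel, and it is bounded by 1.\<close>

lemma share_integrable:
  assumes "\<forall>j\<in>{1..N}. s j \<noteq> []" "i \<in> {1..N}"
  shows "share N s i integrable_on {0..1}"
proof -
  define R where "R j = {t. reaches (rival_locations N s j) (set (s j)) t}" for j
  have [measurable]: "R j \<in> sets borel" for j
    unfolding R_def by (intro borel_closed closed_reaches) simp
  have card_eq: "real (card (closest_players N s t)) = (\<Sum>j\<in>{1..N}. indicator (R j) t)" for t
  proof -
    have "closest_players N s t = {j \<in> {1..N}. t \<in> R j}"
      using in_closest_players_iff_reaches[OF assms(1)] closest_players_def[of N s t]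
      unfolding R_def by blast
    then show ?thesis
      by (simp add: indicator_def of_bool_def sum.If_cases Int_def)
  qed
  have "share N s i = (\<lambda>t. indicator (R i) t / (\<Sum>j\<in>{1..N}. indicator (R j) t))"
    unfolding share_def card_eq in_closest_players_iff_reaches[OF assms]
    by (auto simp: R_def indicator_def)
  then have "share N s i \<in> borel_measurable borel" by simp
  then have "share N s i \<in> borel_measurable (lebesgue_on {0..1})"
    by (simp add: measurable_completion measurable_restrict_space1)
  then show ?thesis
    by (rule measurable_bounded_by_integrable_imp_integrable_real[where g="\<lambda>_. 1"])
       (auto simp: share_nonneg share_le_1 integrable_on_const)
qed

lemma sum_payoff_eq_1:
  assumes "\<forall>j\<in>{1..N}. s j \<noteq> []" "1 \<le> N"
  shows "(\<Sum>i\<in>{1..N}. payoff N s i) = 1"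
proof -
  have sum1: "(\<Sum>i\<in>{1..N}. share N s i t) = 1" for t
  proof -
    have "(\<Sum>i\<in>{1..N}. share N s i t)
        = (\<Sum>i\<in>{1..N}. of_bool (i \<in> closest_players N s t)) / real (card (closest_players N s t))"
      unfolding share_def sum_divide_distrib ..
    also have "(\<Sum>i\<in>{1..N}. of_bool (i \<in> closest_players N s t)) = real (card (closest_players N s t))"
    proof -
      have "{1..N} \<inter> closest_players N s t = closest_players N s t"
        by (auto simp: closest_players_def)
      then show ?thesis by (simp add: of_bool_def sum.If_cases)
    qed
    finally show ?thesis
      using closest_players_nonempty[OF assms] by simp
  qed
  have "(\<Sum>i\<in>{1..N}. payoff N s i) = integral {0..1} (\<lambda>t. \<Sum>i\<in>{1..N}. share N s i t)"
    unfolding payoff_eq_integral_share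
    by (rule integral_sum[symmetric]) (use assms share_integrable in auto)
  then show ?thesis using sum1 by simp
qed

section \<open>Winning sets and one-sided reaches\<close>

text \<open>A facility on a point of \<open>F\<close> serves only customers that are not to its
  left, as if it were shifted infinitesimally to the right. Weak inequalities make the set compact
  and hence measurable.\<close>

definition left_reach :: "real set \<Rightarrow> real set \<Rightarrow> real set" where
  "left_reach F X = {t \<in> {0..1}. \<exists>x\<in>X. (x \<in> F \<longrightarrow> x \<le> t) \<and> (\<forall>f\<in>F. \<bar>t - x\<bar> \<le> \<bar>t - f\<bar>)}"

definition right_reach :: "real set \<Rightarrow> real set \<Rightarrow> real set" where
  "right_reach F X = {t \<in> {0..1}. \<exists>x\<in>X. (x \<in> F \<longrightarrow> t \<le> x) \<and> (\<forall>f\<in>F. \<bar>t - x\<bar> \<le> \<bar>t - f\<bar>)}"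

definition winning_set :: "real set \<Rightarrow> real set \<Rightarrow> real set" where
  "winning_set F X = {t \<in> {0..1}. wins F X t}"

text \<open>An upper bound \<open>u\<close> takes the place of the supremum over all placements.
  Allowing fewer than \<open>k\<close> facilities lets a construction leave some of them
  out.\<close>

definition winning_bound :: "real set \<Rightarrow> nat \<Rightarrow> real \<Rightarrow> bool" where
  "winning_bound F k u \<longleftrightarrow>
    (\<forall>Y. finite Y \<and> Y \<subseteq> {0..1} \<and> card Y \<le> k \<longrightarrow> measure lebesgue (winning_set F Y) \<le> u)"

section \<open>Measurability, and reflection of the unit interval\<close>

lemma compact_left_reach: "finite X \<Longrightarrow> compact (left_reach F X)"
proof -
  assume X: "finite X"
  have "left_reach F X = {0..1} \<inter> (\<Union>x\<in>X. (if x \<in> F then {x..} else UNIV) \<inter> (\<Inter>f\<in>F. {t. \<bar>t - x\<bar> \<le> \<bar>t - f\<bar>}))"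
  proof -
    have if_iff: "t \<in> (if x \<in> F then {x..} else UNIV) \<longleftrightarrow> (x \<in> F \<longrightarrow> x \<le> t)" for t x :: real
      by simp
    show ?thesis
      unfolding set_eq_iff left_reach_def Int_iff UN_iff INT_iff if_iff by blast
  qed
  moreover have "closed (\<Union>x\<in>X. (if x \<in> F then {x..} else UNIV) \<inter> (\<Inter>f\<in>F. {t. \<bar>t - x\<bar> \<le> \<bar>t - f\<bar>}))"
    using X by (intro closed_UN closed_Int closed_INT ballI closed_Collect_le continuous_intros) auto
  ultimately show ?thesis
    by (simp add: compact_Int_closed)
qed

lemma lmeasurable_left_reach [simp]: "finite X \<Longrightarrow> left_reach F X \<in> lmeasurable"
  by (intro lmeasurable_compact compact_left_reach)

lemma wins_reflect: "wins ((-) 1 ` F) ((-) 1 ` X) (1 - t) \<longleftrightarrow> wins F X t"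
  by (auto simp: wins_def abs_minus_commute)

lemma winning_set_reflect: "winning_set ((-) 1 ` F) ((-) 1 ` X) = (-) 1 ` winning_set F X"
proof -
  have "t \<in> (-) 1 ` winning_set F X" if "t \<in> winning_set ((-) 1 ` F) ((-) 1 ` X)" for t
    using that wins_reflect[of F X "1 - t"]
    by (intro image_eqI[of _ _ "1 - t"]) (auto simp: winning_set_def)
  then show ?thesis
    by (auto simp: winning_set_def wins_reflect)
qed

text \<open>Reflection exchanges left and right, so bounds proved for \<open>left_reach\<close>
  carry over to \<open>right_reach\<close>.\<close>

lemma right_reach_eq_reflect: "right_reach F X = (-) 1 ` left_reach ((-) 1 ` F) ((-) 1 ` X)"
proof -
  have abs_eq: "\<bar>1 - t - (1 - x)\<bar> = \<bar>t - x\<bar>" for t x :: real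
    by arith
  have "1 - t \<in> left_reach ((-) 1 ` F) ((-) 1 ` X) \<longleftrightarrow> t \<in> right_reach F X" for t
    unfolding left_reach_def right_reach_def
    by (simp add: abs_eq inj_image_mem_iff) (simp add: conj_ac abs_minus_commute)
  then have "right_reach F X = {t. 1 - t \<in> left_reach ((-) 1 ` F) ((-) 1 ` X)}"
    by blast
  then show ?thesis
    by (auto intro: image_eqI[of _ _ "1 - t" for t])
qed

lemma measure_reflect: "measure lebesgue ((-) 1 ` S) = measure lebesgue (S :: real set)"
proof -
  have "(-) 1 ` S = (\<lambda>x. -1 *\<^sub>R x + 1) ` S"
    by (intro image_cong) auto
  then show ?thesis
    using measure_lebesgue_affine[of "-1" 1 S] by (simp add: algebra_simps)
qed

lemma lmeasurable_right_reach [simp]: "finite X \<Longrightarrow> right_reach F X \<in> lmeasurable"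
  unfolding right_reach_eq_reflect
  by (intro lmeasurable_compact compact_continuous_image compact_left_reach continuous_intros) simp

lemma winning_set_lmeasurable [simp]:
  assumes "finite X" "finite F"
  shows "winning_set F X \<in> lmeasurable"
proof -
  have "winning_set F X = {0..1} \<inter> (\<Union>x\<in>X. \<Inter>f\<in>F. {t. \<bar>t - x\<bar> < \<bar>t - f\<bar>})"
    by (auto simp: winning_set_def wins_def)
  moreover have "open (\<Union>x\<in>X. \<Inter>f\<in>F. {t. \<bar>t - x\<bar> < \<bar>t - f\<bar>})"
    using assms by (intro open_UN open_INT ballI open_Collect_less continuous_intros) auto
  ultimately show ?thesis
    by (auto intro!: fmeasurable_Int_fmeasurable simp: borel_open)
qed

lemma winning_bound_reflect:
  assumes "winning_bound F k u"
  shows "winning_bound ((-) 1 ` F) k u"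
  unfolding winning_bound_def
proof (intro allI impI, elim conjE)
  fix Y :: "real set"
  assume Y: "finite Y" "Y \<subseteq> {0..1}" "card Y \<le> k"
  have YY: "Y = (-) 1 ` (-) 1 ` Y"
    by (simp add: image_image)
  have "finite ((-) 1 ` Y)" "(-) 1 ` Y \<subseteq> {0..1}" "card ((-) 1 ` Y) \<le> k"
    using Y by (auto simp: card_image)
  then have "measure lebesgue (winning_set F ((-) 1 ` Y)) \<le> u"
    using assms unfolding winning_bound_def by blast
  then show "measure lebesgue (winning_set ((-) 1 ` F) Y) \<le> u"
    by (subst YY) (simp only: winning_set_reflect measure_reflect)
qed

text \<open>Customers won outright have share 1 and all others at least 0. This bounds deviation
  payoffs from below without an analysis of ties.\<close>

lemma measure_winning_set_le_payoff:
  assumes "\<forall>j\<in>{1..N}. s j \<noteq> []" "i \<in> {1..N}"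
  shows "measure lebesgue (winning_set (rival_locations N s i) (set (s i))) \<le> payoff N s i"
proof -
  let ?W = "winning_set (rival_locations N s i) (set (s i))"
  have "?W \<subseteq> {0..1}"
    by (auto simp: winning_set_def)
  then have W: "?W \<in> lmeasurable" "?W \<inter> {0..1} = ?W"
    by (simp_all add: Int_absorb2)
  then have "measure lebesgue ?W = integral {0..1} (indicator ?W)"
    using integral_indicator[of ?W "{0..1}"] by simp
  also have "\<dots> \<le> payoff N s i"
    unfolding payoff_eq_integral_share
  proof (rule integral_le)
    show "(indicator ?W :: real \<Rightarrow> real) integrable_on {0..1}"
      using W by (simp add: integrable_on_indicator)
    show "indicator ?W t \<le> share N s i t" for t
      using share_eq_1[OF assms, of t] share_nonneg[of N s i t]
      by (auto simp: indicator_def winning_set_def)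
  qed (use share_integrable[OF assms] in auto)
  finally show ?thesis .
qed

text \<open>A facility placed on a rival location earns at most half of what it would earn there unrivalled, so
  a shared facility is worth the mean of moving it infinitesimally to the right and to the left.\<close>

lemma payoff_le_mean_reach:
  assumes "\<forall>j\<in>{1..N}. s j \<noteq> []" "i \<in> {1..N}" "2 \<le> N"
  defines "F \<equiv> rival_locations N s i" and "X \<equiv> set (s i)"
  shows "payoff N s i \<le> (measure lebesgue (left_reach F X) + measure lebesgue (right_reach F X)) / 2"
proof -
  let ?A = "left_reach F X" and ?B = "right_reach F X"
  have "?A \<subseteq> {0..1}" "?B \<subseteq> {0..1}"
    by (auto simp: left_reach_def right_reach_def)
  then have A: "?A \<in> lmeasurable" "?A \<inter> {0..1} = ?A" and B: "?B \<in> lmeasurable" "?B \<inter> {0..1} = ?B"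
    by (simp_all add: X_def Int_absorb2)
  have int: "(\<lambda>t. (indicator ?A t + indicator ?B t) / 2 :: real) integrable_on {0..1}"
    using A B by (intro integrable_on_divide integrable_add) (simp_all add: integrable_on_indicator)
  have "payoff N s i \<le> integral {0..1} (\<lambda>t. (indicator ?A t + indicator ?B t) / 2)"
    unfolding payoff_eq_integral_share
  proof (rule integral_le[OF share_integrable[OF assms(1,2)] int])
    fix t :: real
    assume t: "t \<in> {0..1}"
    \<comment> \<open>A share of 1 is matched by both indicators, a share of at most 1/2 by at least
      one of them.\<close>
    consider "wins F X t" | "\<not> wins F X t" "reaches F X t" | "\<not> reaches F X t" by blast
    then show "share N s i t \<le> (indicator ?A t + indicator ?B t) / 2"
    proof cases
      case 1
      then obtain x where x: "x \<in> X" "\<forall>f\<in>F. \<bar>t - x\<bar> < \<bar>t - f\<bar>"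
        by (auto simp: wins_def)
      then have "x \<notin> F" by blast
      then have "t \<in> ?A" "t \<in> ?B"
        using x t by (auto simp: left_reach_def right_reach_def intro!: bexI[of _ x] less_imp_le)
      then show ?thesis using share_le_1[of N s i t] by simp
    next
      case 2
      then obtain x where x: "x \<in> X" "\<forall>f\<in>F. \<bar>t - x\<bar> \<le> \<bar>t - f\<bar>"
        by (auto simp: reaches_def)
      then have "t \<in> ?A \<or> t \<in> ?B"
        using t linear[of x t] unfolding left_reach_def right_reach_def by blast
      moreover have "share N s i t \<le> 1 / 2"
        using share_le_half[OF assms(1-3)] 2 unfolding F_def X_def by blast
      ultimately show ?thesis by (auto simp: indicator_def)
    next
      case 3
      then have "share N s i t = 0"
        using share_eq_0[OF assms(1,2)] unfolding F_def X_def by blast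
      then show ?thesis by simp
    qed
  qed
  also have "\<dots> = (integral {0..1} (indicator ?A) + integral {0..1} (indicator ?B)) / 2"
    using A B by (subst integral_divide, subst Henstock_Kurzweil_Integration.integral_add) (simp_all add: integrable_on_indicator)
  finally show ?thesis
    using A B integral_indicator[of ?A "{0..1}"] integral_indicator[of ?B "{0..1}"] by simp
qed

section \<open>Gaps between rival locations\<close>

text \<open>The rival locations are \<open>q 1 < \<dots> < q L\<close>; the reflected points \<open>q 0 = - q 1\<close> and
  \<open>q (L + 1) = 2 - q L\<close> make the two end gaps look like halves of interior gaps.\<close>

locale gaps =
  fixes L :: nat and q :: "nat \<Rightarrow> real" and F :: "real set"
  assumes L_pos: "1 \<le> L"
    and strict_mono_q: "strict_mono_on {1..L} q"
    and F_eq: "F = q ` {1..L}"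
    and F_subset: "F \<subseteq> {0..1}"
    and q_0: "q 0 = - q 1"
    and q_Suc_L: "q (Suc L) = 2 - q L"
begin

text \<open>What one facility strictly inside an interior gap wins, wherever it stands. For an end
  gap it is the full length between the outermost rival and the border.\<close>

definition half_gap :: "nat \<Rightarrow> real" where
  "half_gap g = (q (Suc g) - q g) / 2"

text \<open>The number of facilities that suffices to win nearly the whole gap: one next to the only
  rival of an end gap, two next to both ends of an interior gap.\<close>

definition capacity :: "nat \<Rightarrow> nat" where
  "capacity g = (if g = 0 \<or> g = L then 1 else 2)"

text \<open>Each region contains its left end, in accordance with the shift to the right in
  \<open>left_reach\<close>: a facility on \<open>q g\<close> counts for the gap to its
  right.\<close>

definition region :: "nat \<Rightarrow> real set" where
  "region g = (if g = L then {q L..} else {q g..<q (Suc g)})"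

lemma q_bounds: "1 \<le> g \<Longrightarrow> g \<le> L \<Longrightarrow> 0 \<le> q g \<and> q g \<le> 1"
  using F_subset F_eq by (auto simp: image_subset_iff)

lemma q_in_F: "1 \<le> g \<Longrightarrow> g \<le> L \<Longrightarrow> q g \<in> F"
  by (simp add: F_eq)

lemma q_step: "g \<le> L \<Longrightarrow> q g \<le> q (Suc g)"
proof -
  assume g: "g \<le> L"
  consider "g = 0" | "g = L" "g \<noteq> 0" | "1 \<le> g" "g < L" using g by linarith
  then show ?thesis
  proof cases
    case 1
    then show ?thesis using q_0 q_bounds[of 1] L_pos by simp
  next
    case 2
    then show ?thesis using q_Suc_L q_bounds[of L] L_pos by simp
  next
    case 3
    then show ?thesis using strict_mono_onD[OF strict_mono_q, of g "Suc g"] by simp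
  qed
qed

lemma q_mono: "i \<le> j \<Longrightarrow> j \<le> Suc L \<Longrightarrow> q i \<le> q j"
proof (induction j rule: dec_induct)
  case (step j)
  then show ?case using q_step[of j] by simp
qed simp

lemma half_gap_nonneg: "g \<le> L \<Longrightarrow> 0 \<le> half_gap g"
  using q_step by (simp add: half_gap_def)

lemma half_gap_interior_pos: "1 \<le> g \<Longrightarrow> g < L \<Longrightarrow> 0 < half_gap g"
  using strict_mono_onD[OF strict_mono_q, of g "Suc g"] by (simp add: half_gap_def)

lemma F_cases:
  assumes "f \<in> F" "g \<le> L"
  shows "f \<le> q g \<or> q (Suc g) \<le> f"
proof -
  obtain j where j: "f = q j" "1 \<le> j" "j \<le> L" using assms(1) by (auto simp: F_eq)
  show ?thesis
    using q_mono[of j g] q_mono[of "Suc g" j] j assms(2) by (cases "j \<le> g") auto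
qed

text \<open>Each summand is the length of the part of the gap inside the unit interval. The sum
  telescopes after the reflected halves of the two end gaps are taken off.\<close>

lemma sum_capacity_half_gap: "(\<Sum>g\<le>L. capacity g * half_gap g) = 1"
proof -
  have "(\<Sum>g\<le>L. capacity g * half_gap g)
      = (\<Sum>g\<le>L. q (Suc g) - q g) - (\<Sum>g\<le>L. (if g = 0 then half_gap 0 else 0) + (if g = L then half_gap L else 0))"
    unfolding sum_subtractf[symmetric]
    using L_pos by (intro sum.cong) (auto simp: capacity_def half_gap_def field_simps)
  also have "(\<Sum>g\<le>L. q (Suc g) - q g) = q (Suc L) - q 0"
    using sum_telescope[of "\<lambda>g. - q g" L] by simp
  also have "(\<Sum>g\<le>L. (if g = 0 then half_gap 0 else 0) + (if g = L then half_gap L else 0)) = half_gap 0 + half_gap L"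
    by (simp add: sum.distrib)
  finally show ?thesis
    using q_0 q_Suc_L by (simp add: half_gap_def field_simps)
qed

lemma ex_gap:
  assumes "0 \<le> t" "t \<le> 1"
  shows "\<exists>g\<le>L. q g \<le> t \<and> t \<le> q (Suc g)"
proof -
  have ex: "t \<le> q (Suc L)"
    using assms q_Suc_L q_bounds[of L] L_pos by simp
  define g where "g = (LEAST g. t \<le> q (Suc g))"
  have g: "t \<le> q (Suc g)" "g \<le> L"
    unfolding g_def using ex by (auto intro: LeastI Least_le)
  have "q g \<le> t"
  proof (cases g)
    case 0
    then show ?thesis using assms q_0 q_bounds[of 1] L_pos by simp
  next
    case (Suc g')
    then have "\<not> t \<le> q (Suc g')"
      using not_less_Least[of g' "\<lambda>g. t \<le> q (Suc g)"] by (simp add: g_def)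
    then show ?thesis using Suc by simp
  qed
  then show ?thesis using g by blast
qed

lemma wins_in_gap:
  assumes g: "g \<le> L" and y: "y1 \<in> Y" "y2 \<in> Y" "q g < y1" "y1 \<le> y2" "y2 < q (Suc g)"
    and t: "(q g + y1) / 2 < t" "t < (y2 + q (Suc g)) / 2"
  shows "wins F Y t"
proof -
  \<comment> \<open>\<open>y1\<close> wins up to its midpoint with the right end; from there on
    \<open>t\<close> is already beyond the midpoint of \<open>q g\<close> and \<open>y2\<close>, so
    \<open>y2\<close> wins.\<close>
  define y where "y = (if t < (y1 + q (Suc g)) / 2 then y1 else y2)"
  have "y \<in> Y" using y by (simp add: y_def)
  moreover have "\<bar>t - y\<bar> < \<bar>t - f\<bar>" if "f \<in> F" for f
    using F_cases[OF that g] y t by (auto simp: y_def abs_if split: if_splits)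
  ultimately show ?thesis by (auto simp: wins_def)
qed

text \<open>Each of \<open>c\<close> facilities can secure one \<open>half_gap\<close> up to an
  arbitrarily small loss. \<open>U\<close> collects the customers of the gap that may fail to be
  won.\<close>

lemma ex_gap_placement:
  assumes g: "g \<le> L" and c: "c \<le> capacity g" and e: "0 < e"
  shows "\<exists>Y U. finite Y \<and> Y \<subseteq> {0..1} \<and> card Y \<le> c \<and> U \<in> lmeasurable \<and>
    measure lebesgue U \<le> (real (capacity g) - real c) * half_gap g + e \<and>
    (\<forall>t\<in>{0..1}. q g \<le> t \<and> t \<le> q (Suc g) \<longrightarrow> t \<in> U \<or> wins F Y t)"
proof (cases "c = 0")
  case True
  define U where "U = {max 0 (q g)..min 1 (q (Suc g))}"
  have "measure lebesgue U \<le> real (capacity g) * half_gap g"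
  proof -
    consider "g = 0" | "g = L" "g \<noteq> 0" | "1 \<le> g" "g < L" using g by linarith
    then show ?thesis
      using q_step[OF g] q_0 q_Suc_L q_bounds[of 1] q_bounds[of L] L_pos
      by cases (auto simp: U_def capacity_def half_gap_def max_def min_def)
  qed
  then show ?thesis
    using True e by (intro exI[of _ "{}"] exI[of _ U]) (auto simp: U_def)
next
  case c0: False
  show ?thesis
  proof (cases "half_gap g = 0")
    case True
    \<comment> \<open>The gap is a single point, so no facility is placed and the null set is given
      up.\<close>
    then have "measure lebesgue {q g..q (Suc g)} = 0"
      by (simp add: half_gap_def)
    then show ?thesis
      using True e by (intro exI[of _ "{}"] exI[of _ "{q g..q (Suc g)}"]) simp
  next
    case False
    then have h: "q g < q (Suc g)"
      using half_gap_nonneg[OF g] by (simp add: half_gap_def)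
    \<comment> \<open>All remaining cases place an outermost pair \<open>y1 \<le> y2\<close>, with
      \<open>y1 = y2\<close> when \<open>c = 1\<close>. At most the stretches outside the midpoints
      with the gap's ends are lost.\<close>
    have goal: ?thesis
      if y: "q g < y1" "y1 \<le> y2" "y2 < q (Suc g)" "0 \<le> y1" "y2 \<le> 1" "card {y1, y2} \<le> c"
        and m: "max 0 ((q g + y1) / 2 - max 0 (q g)) + max 0 (min 1 (q (Suc g)) - (y2 + q (Suc g)) / 2)
          \<le> (real (capacity g) - real c) * half_gap g + e" for y1 y2
    proof -
      define A where "A = {max 0 (q g)..(q g + y1) / 2}"
      define B where "B = {(y2 + q (Suc g)) / 2..min 1 (q (Suc g))}"
      have AB: "measure lebesgue (A \<union> B) \<le> (real (capacity g) - real c) * half_gap g + e"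
        using measure_Un_le[of A lebesgue B] m
        by (auto simp: A_def B_def max_def split: if_splits)
      have "t \<in> A \<union> B \<or> wins F {y1, y2} t"
        if "t \<in> {0..1}" "q g \<le> t" "t \<le> q (Suc g)" for t
      proof (rule disjCI)
        assume "\<not> wins F {y1, y2} t"
        then have "t \<le> (q g + y1) / 2 \<or> (y2 + q (Suc g)) / 2 \<le> t"
          using wins_in_gap[OF g, of y1 "{y1, y2}" y2 t] y by force
        then show "t \<in> A \<union> B"
          using that by (auto simp: A_def B_def)
      qed
      moreover have "A \<union> B \<in> lmeasurable" by (auto simp: A_def B_def)
      ultimately show ?thesis
        using AB y by (intro exI[of _ "{y1, y2}"] exI[of _ "A \<union> B"]) auto
    qed
    consider "g = 0" | "g = L" "g \<noteq> 0" | "1 \<le> g" "g < L" "c = 1" | "1 \<le> g" "g < L" "c = 2"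
      using g c c0 by (fastforce simp: capacity_def split: if_splits)
    then show ?thesis
    proof cases
      case 1
      \<comment> \<open>Just to the left of the first rival; the next case mirrors this at the last
        rival.\<close>
      define y where "y = max 0 (q 1 - e)"
      have "c = 1" using 1 c c0 by (simp add: capacity_def)
      then show ?thesis
        using 1 h e q_0 q_bounds[of 1] L_pos
        by (intro goal[of y y]) (auto simp: y_def capacity_def max_def min_def field_simps)
    next
      case 2
      define y where "y = min 1 (q L + e)"
      have "c = 1" using 2 c c0 by (simp add: capacity_def)
      then show ?thesis
        using 2 h e q_Suc_L q_bounds[of L] L_pos
        by (intro goal[of y y]) (auto simp: y_def capacity_def max_def min_def field_simps)
    next
      case 3
      then show ?thesis
        using h e q_bounds[of g] q_bounds[of "Suc g"]
        by (intro goal[of "(q g + q (Suc g)) / 2" "(q g + q (Suc g)) / 2"])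
           (auto simp: capacity_def half_gap_def max_def min_def field_simps)
    next
      case 4
      \<comment> \<open>The two facilities stand at distance \<open>d\<close> from the ends;
        \<open>d \<le> half_gap g\<close> keeps them in order.\<close>
      define d where "d = min e (half_gap g)"
      have "0 < d" using e h by (simp add: d_def half_gap_def)
      moreover have "d \<le> e" "d \<le> half_gap g" by (simp_all add: d_def)
      ultimately show ?thesis
        using 4 h e q_bounds[of g] q_bounds[of "Suc g"]
        by (intro goal[of "q g + d" "q (Suc g) - d"])
           (auto simp: capacity_def half_gap_def max_def min_def card_insert_if field_simps)
    qed
  qed
qed

text \<open>The placements of all gaps are combined. What is not won has measure at most
  \<open>1 - (\<Sum>g\<le>L. c g * half_gap g) + e\<close>, so \<open>u\<close> falls short of the
  weighted sum by at most \<open>e\<close>.\<close>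

lemma weighted_half_gaps_le:
  assumes bound: "winning_bound F k u"
    and c: "\<And>g. g \<le> L \<Longrightarrow> c g \<le> capacity g" and ck: "(\<Sum>g\<le>L. c g) \<le> k"
  shows "(\<Sum>g\<le>L. c g * half_gap g) \<le> u"
proof (rule field_le_epsilon)
  fix e :: real
  assume e: "0 < e"
  \<comment> \<open>There are \<open>L + 1\<close> gaps, including the two end gaps.\<close>
  define d where "d = e / (L + 1)"
  have d: "0 < d" using e by (simp add: d_def)
  have "\<forall>g\<in>{..L}. \<exists>Y U. finite Y \<and> Y \<subseteq> {0..1} \<and> card Y \<le> c g \<and> U \<in> lmeasurable \<and>
    measure lebesgue U \<le> (real (capacity g) - real (c g)) * half_gap g + d \<and>
    (\<forall>t\<in>{0..1}. q g \<le> t \<and> t \<le> q (Suc g) \<longrightarrow> t \<in> U \<or> wins F Y t)"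
    using ex_gap_placement[OF _ c d] by simp
  then obtain Y U where YU: "\<And>g. g \<le> L \<Longrightarrow> finite (Y g) \<and> Y g \<subseteq> {0..1} \<and> card (Y g) \<le> c g \<and>
    U g \<in> lmeasurable \<and> measure lebesgue (U g) \<le> (real (capacity g) - real (c g)) * half_gap g + d \<and>
    (\<forall>t\<in>{0..1}. q g \<le> t \<and> t \<le> q (Suc g) \<longrightarrow> t \<in> U g \<or> wins F (Y g) t)"
    unfolding bchoice_iff by (auto simp: Ball_def)
  define Z where "Z = (\<Union>g\<le>L. Y g)"
  have Z: "finite Z" "Z \<subseteq> {0..1}"
    using YU by (auto simp: Z_def)
  have "card Z \<le> (\<Sum>g\<le>L. card (Y g))"
    unfolding Z_def by (rule card_UN_le) simp
  also have "\<dots> \<le> (\<Sum>g\<le>L. c g)" using YU by (intro sum_mono) simp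
  finally have "card Z \<le> k" using ck by simp
  then have W: "measure lebesgue (winning_set F Z) \<le> u"
    using bound Z by (simp add: winning_bound_def)
  have WZ: "winning_set F Z \<in> lmeasurable"
    using Z F_eq by simp
  have "{0..1} \<subseteq> winning_set F Z \<union> (\<Union>g\<le>L. U g)"
  proof
    fix t :: real
    assume t: "t \<in> {0..1}"
    then obtain g where g: "g \<le> L" "q g \<le> t" "t \<le> q (Suc g)"
      using ex_gap[of t] by auto
    then have "t \<in> U g \<or> wins F (Y g) t"
      using YU t by blast
    moreover have "wins F Z t" if "wins F (Y g) t"
      using that g by (auto simp: wins_def Z_def)
    ultimately show "t \<in> winning_set F Z \<union> (\<Union>g\<le>L. U g)"
      using t g by (auto simp: winning_set_def)
  qed
  then have "measure lebesgue {0..1::real} \<le> measure lebesgue (winning_set F Z \<union> (\<Union>g\<le>L. U g))"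
    using WZ YU by (intro measure_mono_fmeasurable fmeasurable.Un fmeasurable.finite_UN) auto
  also have "\<dots> \<le> measure lebesgue (winning_set F Z) + measure lebesgue (\<Union>g\<le>L. U g)"
    using WZ YU by (intro measure_Un_le) auto
  also have "measure lebesgue (\<Union>g\<le>L. U g) \<le> (\<Sum>g\<le>L. measure lebesgue (U g))"
    using YU by (intro measure_UNION_le) auto
  also have "\<dots> \<le> (\<Sum>g\<le>L. (real (capacity g) - real (c g)) * half_gap g + d)"
    using YU by (intro sum_mono) simp
  also have "\<dots> = 1 - (\<Sum>g\<le>L. c g * half_gap g) + e"
    using sum_capacity_half_gap
    by (simp add: sum.distrib sum_subtractf left_diff_distrib d_def)
  finally show "(\<Sum>g\<le>L. c g * half_gap g) \<le> u + e"
    using W by simp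
qed

section \<open>Upper bounds for the left reach, region by region\<close>

lemma ex_region:
  assumes "0 \<le> x"
  shows "\<exists>g\<le>L. x \<in> region g"
proof (cases "q L \<le> x")
  case True
  then show ?thesis by (auto simp: region_def)
next
  case False
  define g where "g = (LEAST g. x < q (Suc g))"
  have ex: "x < q (Suc (L - 1))" using False L_pos by simp
  then have g: "x < q (Suc g)" "g \<le> L - 1"
    unfolding g_def by (auto intro: LeastI[of "\<lambda>g. x < q (Suc g)"] Least_le)
  have "q g \<le> x"
  proof (cases g)
    case 0
    then show ?thesis using assms q_0 q_bounds[of 1] L_pos by simp
  next
    case (Suc g')
    then have "\<not> x < q (Suc g')"
      using not_less_Least[of g' "\<lambda>g. x < q (Suc g)"] by (simp add: g_def)
    then show ?thesis using Suc by simp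
  qed
  then show ?thesis
    using g L_pos by (intro exI[of _ g]) (auto simp: region_def)
qed

lemma region_disjoint:
  assumes "g < g'" "g' \<le> L"
  shows "region g \<inter> region g' = {}"
  using q_mono[of "Suc g" g'] assms by (auto simp: region_def split: if_splits)

lemma sum_card_region:
  assumes "finite X" "X \<subseteq> {0..1}"
  shows "(\<Sum>g\<le>L. card (X \<inter> region g)) = card X"
proof -
  have "X = (\<Union>g\<le>L. X \<inter> region g)"
    using ex_region assms(2) by (auto simp: subset_iff)
  moreover have "(X \<inter> region g) \<inter> (X \<inter> region g') = {}" if "g \<le> L" "g' \<le> L" "g \<noteq> g'" for g g'
    using region_disjoint[of g g'] region_disjoint[of g' g] that by (cases "g < g'") auto
  ultimately show ?thesis
    using card_UN_disjoint[of "{..L}" "\<lambda>g. X \<inter> region g"] assms(1) by auto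
qed

text \<open>Only the outermost facilities \<open>a\<close> and \<open>b\<close> of the region
  matter: they confine the reach between their midpoints with the region's ends. A region before the
  last lies strictly left of \<open>q (Suc g)\<close>, so \<open>b\<close> always loses a stretch at
  that end; this gives strictness once the region is filled to capacity.\<close>

lemma ex_region_reach:
  assumes g: "g \<le> L" and X: "finite X" "X \<subseteq> {0..1}"
  defines "k \<equiv> card (X \<inter> region g)"
  shows "\<exists>J\<in>lmeasurable. left_reach F (X \<inter> region g) \<subseteq> J \<and>
    measure lebesgue J \<le> real (min k (capacity g)) * half_gap g \<and>
    (g < L \<and> capacity g \<le> k \<longrightarrow> measure lebesgue J < real (min k (capacity g)) * half_gap g)"
proof (cases "X \<inter> region g = {}")
  case True
  then show ?thesis
    by (intro bexI[of _ "{}"]) (auto simp: left_reach_def k_def capacity_def)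
next
  case ne: False
  have fin: "finite (X \<inter> region g)" using X by simp
  define a b where "a = Min (X \<inter> region g)" and "b = Max (X \<inter> region g)"
  have a: "a \<in> X" "a \<in> region g" and b: "b \<in> X" "b \<in> region g"
    using Min_in[OF fin ne] Max_in[OF fin ne] by (auto simp: a_def b_def)
  have ab: "a \<le> x" "x \<le> b" if "x \<in> X \<inter> region g" for x
    using Min_le[OF fin that] Max_ge[OF fin that] by (auto simp: a_def b_def)
  define J where "J = {max 0 ((a + q g) / 2)..min 1 ((b + q (Suc g)) / 2)}"
  have "left_reach F (X \<inter> region g) \<subseteq> J"
  proof
    fix t
    assume "t \<in> left_reach F (X \<inter> region g)"
    then obtain x where t: "0 \<le> t" "t \<le> 1" and x: "x \<in> X" "x \<in> region g" "x \<in> F \<longrightarrow> x \<le> t"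
      "\<forall>f\<in>F. \<bar>t - x\<bar> \<le> \<bar>t - f\<bar>"
      by (auto simp: left_reach_def)
    have "(x + q g) / 2 \<le> t"
    proof (cases "g = 0")
      case True
      then show ?thesis using t x L_pos q_0 by (auto simp: region_def)
    next
      case False
      then have "q g \<in> F" "q g \<le> x"
        using q_in_F g x by (auto simp: region_def split: if_splits)
      \<comment> \<open>For a facility on \<open>q g\<close> no midpoint is available; the one-sided
        condition of \<open>left_reach\<close> gives \<open>q g \<le> t\<close> instead.\<close>
      then show ?thesis using x by (cases "x = q g") (auto simp: abs_if split: if_splits)
    qed
    moreover have "t \<le> (x + q (Suc g)) / 2"
    proof (cases "g = L")
      case True
      then show ?thesis using t x q_Suc_L by (auto simp: region_def)
    next
      case False
      then have "q (Suc g) \<in> F" "x < q (Suc g)"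
        using q_in_F g x by (auto simp: region_def)
      then show ?thesis using x by (auto simp: abs_if split: if_splits)
    qed
    ultimately show "t \<in> J"
      using ab[of x] x t by (auto simp: J_def)
  qed
  moreover have "J \<in> lmeasurable" by (simp add: J_def)
  moreover have "measure lebesgue J \<le> real (min k (capacity g)) * half_gap g \<and>
    (g < L \<and> capacity g \<le> k \<longrightarrow> measure lebesgue J < real (min k (capacity g)) * half_gap g)"
  proof -
    have k1: "1 \<le> k" using ne fin by (simp add: k_def Suc_le_eq card_gt_0_iff)
    have J: "measure lebesgue J = max 0 (min 1 ((b + q (Suc g)) / 2) - max 0 ((a + q g) / 2))"
      by (simp add: J_def max_def)
    consider "g = 0" | "g = L" "g \<noteq> 0" | "1 \<le> g" "g < L" "k = 1" | "1 \<le> g" "g < L" "2 \<le> k"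
      using g k1 by linarith
    then show ?thesis
    proof cases
      case 1
      then have "min k (capacity g) = 1" using k1 by (simp add: capacity_def)
      then show ?thesis
        using 1 J a b q_0 q_bounds[of 1] L_pos X
        by (auto simp: region_def half_gap_def max_def min_def)
    next
      case 2
      then have "min k (capacity g) = 1" using k1 by (simp add: capacity_def)
      then show ?thesis
        using 2 J a b q_Suc_L q_bounds[of L] L_pos X
        by (auto simp: region_def half_gap_def max_def min_def)
    next
      case 3
      then obtain x where "X \<inter> region g = {x}"
        using card_1_singletonE k_def by metis
      then have "a = b" by (simp add: a_def b_def)
      then show ?thesis
        using 3 J half_gap_interior_pos[of g] q_bounds[of g] q_bounds[of "Suc g"] a
        by (auto simp: capacity_def half_gap_def region_def max_def min_def field_simps)
    next
      case 4
      then have "min k (capacity g) = 2" by (simp add: capacity_def)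
      then show ?thesis
        using 4 J half_gap_interior_pos[of g] q_bounds[of g] q_bounds[of "Suc g"] a b
        by (auto simp: half_gap_def region_def max_def min_def field_simps)
    qed
  qed
  ultimately show ?thesis by blast
qed

text \<open>Facilities beyond the capacity of a region add nothing, so truncated counts
  \<open>c g\<close> suffice, and they fit into the budget \<open>k\<close>. A strict loss in one
  region makes the total strict.\<close>

lemma left_reach_le:
  assumes bound: "winning_bound F k u" and X: "finite X" "X \<subseteq> {0..1}" "card X \<le> k"
  shows "measure lebesgue (left_reach F X) \<le> u"
    and "g < L \<Longrightarrow> capacity g \<le> card (X \<inter> region g) \<Longrightarrow> measure lebesgue (left_reach F X) < u"
proof -
  define c where "c g = min (card (X \<inter> region g)) (capacity g)" for g
  have "\<forall>g\<in>{..L}. \<exists>J. J \<in> lmeasurable \<and> left_reach F (X \<inter> region g) \<subseteq> J \<and>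
    measure lebesgue J \<le> c g * half_gap g \<and>
    (g < L \<and> capacity g \<le> card (X \<inter> region g) \<longrightarrow> measure lebesgue J < c g * half_gap g)"
    using ex_region_reach[OF _ X(1,2)] unfolding c_def by (auto simp: Bex_def)
  then obtain J where J: "\<And>g. g \<le> L \<Longrightarrow> J g \<in> lmeasurable \<and> left_reach F (X \<inter> region g) \<subseteq> J g \<and>
    measure lebesgue (J g) \<le> c g * half_gap g \<and>
    (g < L \<and> capacity g \<le> card (X \<inter> region g) \<longrightarrow> measure lebesgue (J g) < c g * half_gap g)"
    unfolding bchoice_iff by (auto simp: Ball_def)
  have "left_reach F X \<subseteq> (\<Union>g\<le>L. left_reach F (X \<inter> region g))"
  proof
    fix t
    assume "t \<in> left_reach F X"
    then obtain x where x: "t \<in> {0..1}" "x \<in> X" "x \<in> F \<longrightarrow> x \<le> t" "\<forall>f\<in>F. \<bar>t - x\<bar> \<le> \<bar>t - f\<bar>"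
      unfolding left_reach_def by blast
    moreover have "0 \<le> x" using x(2) X(2) by auto
    ultimately obtain g where "g \<le> L" "x \<in> region g" using ex_region[of x] by blast
    then show "t \<in> (\<Union>g\<le>L. left_reach F (X \<inter> region g))"
      using x unfolding left_reach_def by blast
  qed
  also have "\<dots> \<subseteq> (\<Union>g\<le>L. J g)"
    using J by (intro UN_mono) auto
  finally have "left_reach F X \<subseteq> (\<Union>g\<le>L. J g)" .
  then have "measure lebesgue (left_reach F X) \<le> measure lebesgue (\<Union>g\<le>L. J g)"
    using J X by (intro measure_mono_fmeasurable fmeasurable.finite_UN fmeasurableD lmeasurable_left_reach) auto
  also have "\<dots> \<le> (\<Sum>g\<le>L. measure lebesgue (J g))"
    using J by (intro measure_UNION_le) auto
  finally have le: "measure lebesgue (left_reach F X) \<le> (\<Sum>g\<le>L. measure lebesgue (J g))" .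
  have "(\<Sum>g\<le>L. c g) \<le> (\<Sum>g\<le>L. card (X \<inter> region g))"
    by (intro sum_mono) (simp add: c_def)
  then have cu: "(\<Sum>g\<le>L. c g * half_gap g) \<le> u"
    using X sum_card_region[OF X(1,2)] by (intro weighted_half_gaps_le[OF bound]) (auto simp: c_def)
  have "(\<Sum>g\<le>L. measure lebesgue (J g)) \<le> (\<Sum>g\<le>L. c g * half_gap g)"
    using J by (intro sum_mono) simp
  then show "measure lebesgue (left_reach F X) \<le> u" using le cu by simp
  assume g: "g < L" "capacity g \<le> card (X \<inter> region g)"
  have "(\<Sum>g\<le>L. measure lebesgue (J g)) < (\<Sum>g\<le>L. c g * half_gap g)"
    using J g by (intro sum_strict_mono_ex1) (auto intro!: bexI[of _ g])
  then show "measure lebesgue (left_reach F X) < u" using le cu by simp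
qed

text \<open>Pigeonhole: if no region before the last is filled to capacity, region 0 is empty, each
  interior region holds at most one facility, and the last can hold only \<open>q L\<close>. That
  makes at most \<open>L\<close> facilities.\<close>

lemma left_reach_less:
  assumes bound: "winning_bound F k u" and X: "finite X" "X \<subseteq> {0..1}" "card X \<le> k"
    and many: "L < card X" and no_right: "\<forall>x\<in>X. x \<le> q L"
  shows "measure lebesgue (left_reach F X) < u"
proof -
  have "\<exists>g<L. capacity g \<le> card (X \<inter> region g)"
  proof (rule ccontr)
    assume "\<not> ?thesis"
    then have small: "card (X \<inter> region g) < capacity g" if "g < L" for g
      using that not_le by blast
    have "X \<inter> region L \<subseteq> {q L}" using no_right by (force simp: region_def)
    then have last: "card (X \<inter> region L) \<le> 1"
      using card_mono[of "{q L}"] by fastforce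
    have "card (X \<inter> region g) \<le> (if g = 0 then 0 else 1)" if "g \<le> L" for g
      using small[of g] last that L_pos by (cases "g = L") (auto simp: capacity_def split: if_splits)
    then have "(\<Sum>g\<le>L. card (X \<inter> region g)) \<le> (\<Sum>g\<le>L. if g = 0 then 0 else 1)"
      by (intro sum_mono) auto
    also have "\<dots> = L"
      by (simp add: atMost_atLeast0 sum.atLeast_Suc_atMost)
    finally show False using sum_card_region[OF X(1,2)] many by simp
  qed
  then show ?thesis using left_reach_le(2)[OF bound X] by blast
qed

end

section \<open>No equilibrium with a dominant player\<close>

lemma ex_gaps:
  assumes "finite F" "F \<noteq> {}" "F \<subseteq> {0..1}"
  shows "\<exists>q. gaps (card F) q F"
proof -
  define xs where "xs = sorted_list_of_set F"
  have xs: "length xs = card F" "set xs = F" "sorted_wrt (<) xs"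
    using assms by (auto simp: xs_def)
  define L where "L = card F"
  have L: "1 \<le> L" using assms by (simp add: L_def Suc_le_eq card_gt_0_iff)
  define p where "p g = xs ! (g - 1)" for g
  define q where "q g = (if g = 0 then - p 1 else if g = Suc L then 2 - p L else p g)" for g
  have "strict_mono_on {1..L} q"
    using xs by (auto simp: strict_mono_on_def q_def p_def L_def sorted_wrt_iff_nth_less)
  moreover have "F = q ` {1..L}"
  proof -
    have "F = (!) xs ` {..<L}"
      using xs by (auto simp: set_conv_nth L_def)
    also have "{..<L} = (\<lambda>g. g - 1) ` {1..L}"
      by (auto simp: image_iff intro!: bexI[of _ "Suc g" for g])
    finally show ?thesis
      by (auto simp: image_image q_def p_def)
  qed
  ultimately have "gaps L q F"
    using assms L by unfold_locales (auto simp: q_def)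
  then show ?thesis unfolding L_def by blast
qed

text \<open>If no facility lies to the right of all rivals, the pigeonhole argument applies to the
  left reach. Otherwise the reflected configuration has a facility in its region 0, which is thereby
  filled to capacity, and the right reach is strictly smaller.\<close>

lemma mean_reach_less:
  assumes F: "finite F" "F \<noteq> {}" "F \<subseteq> {0..1}" and X: "finite X" "X \<subseteq> {0..1}"
    and bound: "winning_bound F (card X) u" and card: "card F < card X"
  shows "(measure lebesgue (left_reach F X) + measure lebesgue (right_reach F X)) / 2 < u"
proof -
  obtain q where "gaps (card F) q F" using ex_gaps[OF F] by blast
  then interpret G: gaps "card F" q F .
  define F' X' where "F' = (-) 1 ` F" and "X' = (-) 1 ` X"
  have F': "finite F'" "F' \<noteq> {}" "F' \<subseteq> {0..1}" and X': "finite X'" "X' \<subseteq> {0..1}" "card X' = card X"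
    using F X by (auto simp: F'_def X'_def card_image)
  obtain q' where "gaps (card F') q' F'" using ex_gaps[OF F'] by blast
  then interpret G': gaps "card F'" q' F' .
  have bound': "winning_bound F' (card X) u"
    using winning_bound_reflect[OF bound] by (simp add: F'_def)
  have right: "measure lebesgue (right_reach F X) = measure lebesgue (left_reach F' X')"
    by (simp add: right_reach_eq_reflect measure_reflect F'_def X'_def)
  have le: "measure lebesgue (left_reach F X) \<le> u" "measure lebesgue (left_reach F' X') \<le> u"
    using G.left_reach_le(1)[OF bound X] G'.left_reach_le(1)[OF bound' X'(1,2)] X'(3) by auto
  have "measure lebesgue (left_reach F X) < u \<or> measure lebesgue (left_reach F' X') < u"
  proof (cases "\<forall>x\<in>X. x \<le> q (card F)")
    case True
    then show ?thesis using G.left_reach_less[OF bound X _ card] by simp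
  next
    case False
    then obtain x where x: "x \<in> X" "q (card F) < x" by auto
    have "f < x" if "f \<in> F" for f
      using that x G.F_eq G.q_mono[of _ "card F"] by force
    moreover have "q' 1 \<in> F'" using G'.q_in_F[of 1] G'.L_pos by simp
    ultimately have "1 - x < q' 1" by (auto simp: F'_def)
    moreover have "q' 0 \<le> 0" "0 \<le> 1 - x"
      using G'.q_0 G'.q_bounds[of 1] G'.L_pos x X by auto
    ultimately have "1 - x \<in> X' \<inter> G'.region 0"
      using x G'.L_pos by (auto simp: X'_def G'.region_def)
    then have "1 \<le> card (X' \<inter> G'.region 0)"
      using X' by (simp add: Suc_le_eq card_gt_0_iff) blast
    then show ?thesis
      using G'.left_reach_le(2)[OF bound' X'(1,2), of 0] X'(3) G'.L_pos
      by (simp add: G'.capacity_def)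
  qed
  moreover have "(a + b) / 2 < u" if "a < u \<or> b < u" "a \<le> u" "b \<le> u" for a b :: real
    using that by (auto simp: field_simps)
  ultimately show ?thesis using le right by metis
qed

section \<open>From equilibria to winning bounds\<close>

lemma pure_strategiesD:
  assumes "x \<in> pure_strategies m"
  shows "length x = m" "set x \<subseteq> {0..1}" "card (set x) = m"
  using assms strict_sorted_iff[of x] by (auto simp: pure_strategies_def distinct_card)

lemma sorted_list_of_set_pure_strategy:
  assumes "finite X" "X \<subseteq> {0..1}" "card X = m"
  shows "sorted_list_of_set X \<in> pure_strategies m"
  using assms by (auto simp: pure_strategies_def)

lemma pure_profile_nonempty:
  assumes "pure_profile N n s" "multi_unit_game N n"
  shows "\<forall>j\<in>{1..N}. s j \<noteq> []"
proof
  fix j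
  assume "j \<in> {1..N}"
  then have "length (s j) = n j" "0 < n j"
    using assms by (auto simp: pure_profile_def multi_unit_game_def dest: pure_strategiesD(1))
  then show "s j \<noteq> []" by auto
qed

lemma rival_locations_props:
  assumes "pure_profile N n s"
  shows "rival_locations N s i \<subseteq> {0..1}" "card (rival_locations N s i) \<le> (\<Sum>j\<in>{1..N} - {i}. n j)"
proof -
  show "rival_locations N s i \<subseteq> {0..1}"
    using assms by (auto simp: rival_locations_def pure_profile_def dest!: pure_strategiesD(2))
  have "card (rival_locations N s i) \<le> (\<Sum>j\<in>{1..N} - {i}. card (set (s j)))"
    unfolding rival_locations_def by (rule card_UN_le) simp
  also have "\<dots> = (\<Sum>j\<in>{1..N} - {i}. n j)"
    using assms by (intro sum.cong) (auto simp: pure_profile_def dest!: pure_strategiesD(3))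
  finally show "card (rival_locations N s i) \<le> (\<Sum>j\<in>{1..N} - {i}. n j)" .
qed

lemma pure_profile_fun_upd:
  "pure_profile N n s \<Longrightarrow> x \<in> pure_strategies (n i) \<Longrightarrow> pure_profile N n (s(i := x))"
  by (auto simp: pure_profile_def)

lemma ex_superset_card_unit_interval:
  fixes Y :: "real set"
  assumes "finite Y" "Y \<subseteq> {0..1}" "card Y \<le> m"
  shows "\<exists>Z. finite Z \<and> Y \<subseteq> Z \<and> Z \<subseteq> {0..1} \<and> card Z = m"
proof -
  have "infinite ({0..1::real} - Y)"
    using assms(1) by (simp add: Diff_infinite_finite infinite_Icc)
  then obtain B where B: "B \<subseteq> {0..1} - Y" "finite B" "card B = m - card Y"
    using infinite_arbitrarily_large by blast
  then have "card (Y \<union> B) = m"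
    using assms by (subst card_Un_disjoint) auto
  then show ?thesis using assms B by (intro exI[of _ "Y \<union> B"]) auto
qed

text \<open>Any placement of at most \<open>n i\<close> facilities can be padded to a strategy
  without losing a customer won outright, and deviating to that strategy does not pay.\<close>

lemma winning_bound_Nash:
  assumes game: "multi_unit_game N n" and nash: "pure_Nash_equilibrium N n s" and i: "i \<in> {1..N}"
  shows "winning_bound (rival_locations N s i) (n i) (payoff N s i)"
  unfolding winning_bound_def
proof (intro allI impI, elim conjE)
  fix Y :: "real set"
  assume Y: "finite Y" "Y \<subseteq> {0..1}" "card Y \<le> n i"
  obtain Z where Z: "finite Z" "Y \<subseteq> Z" "Z \<subseteq> {0..1}" "card Z = n i"
    using ex_superset_card_unit_interval[OF Y] by blast
  define x where "x = sorted_list_of_set Z"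
  have x: "x \<in> pure_strategies (n i)" "set x = Z"
    using Z by (auto simp: x_def intro: sorted_list_of_set_pure_strategy)
  have profile: "pure_profile N n (s(i := x))"
    using nash x pure_profile_fun_upd by (auto simp: pure_Nash_equilibrium_def)
  have "winning_set (rival_locations N s i) Y \<subseteq> winning_set (rival_locations N s i) Z"
    using Z(2) by (auto simp: winning_set_def wins_def)
  then have "measure lebesgue (winning_set (rival_locations N s i) Y)
      \<le> measure lebesgue (winning_set (rival_locations N s i) Z)"
    using Y Z by (intro measure_mono_fmeasurable fmeasurableD winning_set_lmeasurable) auto
  also have "\<dots> \<le> payoff N (s(i := x)) i"
    using measure_winning_set_le_payoff[where s = "s(i := x)", OF pure_profile_nonempty[OF profile game] i] x
    by (simp del: fun_upd_apply) simp
  also have "\<dots> \<le> payoff N s i"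
    using nash x i by (auto simp: pure_Nash_equilibrium_def not_less)
  finally show "measure lebesgue (winning_set (rival_locations N s i) Y) \<le> payoff N s i" .
qed

theorem no_Nash_if_dominant:
  assumes game: "multi_unit_game N n" and N: "2 \<le> N" and dom: "has_dominant_player N n"
  shows "\<not> pure_Nash_equilibrium N n s"
proof
  assume nash: "pure_Nash_equilibrium N n s"
  then have profile: "pure_profile N n s" by (simp add: pure_Nash_equilibrium_def)
  note ne = pure_profile_nonempty[OF profile game]
  have NN: "N \<in> {1..N}" using N by simp
  define F X where "F = rival_locations N s N" and "X = set (s N)"
  have "s N \<in> pure_strategies (n N)" using profile NN by (simp add: pure_profile_def)
  note X = pure_strategiesD[OF this, folded X_def]
  have "{1..N} - {N} = {1..N - 1}" by auto
  then have "card F \<le> (\<Sum>j=1..N - 1. n j)"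
    using rival_locations_props(2)[OF profile, of N] by (simp add: F_def)
  then have "card F < card X"
    using dom X by (simp add: has_dominant_player_def)
  moreover have "F \<noteq> {}"
  proof -
    have "1 \<in> {1..N} - {N}" using N by simp
    then show ?thesis using ne unfolding F_def rival_locations_def by fastforce
  qed
  moreover have "F \<subseteq> {0..1}" "finite F"
    using rival_locations_props(1)[OF profile] by (auto simp: F_def)
  moreover have "winning_bound F (card X) (payoff N s N)"
    using winning_bound_Nash[OF game nash NN] X by (simp add: F_def)
  ultimately have "(measure lebesgue (left_reach F X) + measure lebesgue (right_reach F X)) / 2 < payoff N s N"
    using X by (intro mean_reach_less) (auto simp: X_def)
  then show False
    using payoff_le_mean_reach[OF ne NN N] by (simp add: F_def X_def)
qed

section \<open>A sufficient condition for equilibrium\<close>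

text \<open>A facility on a rival location serves customers within \<open>c\<close> on both sides,
  but at most half of each, hence the weight 1/2. A facility between neighbouring rivals serves half
  of their gap, which is at most \<open>2 * c\<close> long.\<close>

lemma single_facility_bound:
  fixes F :: "real set" and x c :: real
  assumes F: "finite F" "F \<subseteq> {0..1}" and x: "x \<in> {0..1}"
    and net: "\<forall>t\<in>{0..1}. \<exists>f\<in>F. \<bar>t - f\<bar> \<le> c"
  shows "\<exists>a b w. a \<le> b \<and> w * (b - a) \<le> c \<and> w = (if x \<in> F then 1 / 2 else 1) \<and>
    (\<forall>t\<in>{0..1}. (\<forall>f\<in>F. \<bar>t - x\<bar> \<le> \<bar>t - f\<bar>) \<longrightarrow> t \<in> {a..b})"
proof (cases "x \<in> F")
  case True
  have "0 \<le> c" using net x by force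
  moreover have "t \<in> {x - c..x + c}" if "t \<in> {0..1}" "\<forall>f\<in>F. \<bar>t - x\<bar> \<le> \<bar>t - f\<bar>" for t
  proof -
    obtain f where "f \<in> F" "\<bar>t - f\<bar> \<le> c" using net \<open>t \<in> {0..1}\<close> by blast
    then have "\<bar>t - x\<bar> \<le> c" using that by force
    then show ?thesis by (auto simp: abs_le_iff)
  qed
  ultimately show ?thesis
    using True by - (rule exI[of _ "x - c"], rule exI[of _ "x + c"], rule exI[of _ "1 / 2"], intro conjI ballI impI, simp_all)
next
  case False
  have goal: ?thesis
    if "a \<le> b" "b - a \<le> c"
      and "\<And>t. t \<in> {0..1} \<Longrightarrow> \<forall>f\<in>F. \<bar>t - x\<bar> \<le> \<bar>t - f\<bar> \<Longrightarrow> t \<in> {a..b}" for a b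
    using that False by - (rule exI[of _ a], rule exI[of _ b], rule exI[of _ 1], simp)
  have lower: "(a + x) / 2 \<le> t" if "a < x" "\<bar>t - x\<bar> \<le> \<bar>t - a\<bar>" for a t
    using that by (auto simp: abs_if split: if_splits)
  have upper: "t \<le> (x + b) / 2" if "x < b" "\<bar>t - x\<bar> \<le> \<bar>t - b\<bar>" for b t
    using that by (auto simp: abs_if split: if_splits)
  have "F \<noteq> {}" using net by fastforce
  define A B where "A = {f \<in> F. f < x}" and "B = {f \<in> F. x < f}"
  have fin: "finite A" "finite B" using F by (auto simp: A_def B_def)
  have mem: "f \<in> A \<or> f \<in> B" if "f \<in> F" for f
    using False that less_linear[of f x] unfolding A_def B_def by blast
  have Max_A: "Max A \<in> F" "Max A < x" if "A \<noteq> {}"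
    using Max_in[OF fin(1) that] by (simp_all add: A_def)
  have Min_B: "Min B \<in> F" "x < Min B" if "B \<noteq> {}"
    using Min_in[OF fin(2) that] by (simp_all add: B_def)
  have gap: "f \<le> Max A \<or> Min B \<le> f" if "f \<in> F" for f
    using mem[OF that] Max_ge[OF fin(1)] Min_le[OF fin(2)] by blast
  consider "A = {}" "B \<noteq> {}" | "B = {}" "A \<noteq> {}" | "A \<noteq> {}" "B \<noteq> {}"
    using mem \<open>F \<noteq> {}\<close> by blast
  then show ?thesis
  proof cases
    case 1
    define b where "b = Min B"
    have b: "b \<in> F" "x < b" using Min_B 1 by (simp_all add: b_def)
    have "b \<le> f" if "f \<in> F" for f
      using mem[OF that] 1 Min_le[OF fin(2)] by (auto simp: b_def)
    \<comment> \<open>The customer at 0 has a rival within \<open>c\<close>, and no rival lies to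
      the left of \<open>b\<close>.\<close>
    moreover obtain f where "f \<in> F" "\<bar>0 - f\<bar> \<le> c" using net by (metis atLeastAtMost_iff order_refl zero_le_one)
    moreover have "0 \<le> b" using b F by auto
    ultimately have "b \<le> c" by fastforce
    then show ?thesis
    proof (intro goal[of 0 "(x + b) / 2"])
      show "t \<in> {0..(x + b) / 2}" if "t \<in> {0..1}" "\<forall>f\<in>F. \<bar>t - x\<bar> \<le> \<bar>t - f\<bar>" for t
        using that upper[OF b(2)] b(1) by auto
    qed (use x b in auto)
  next
    case 2
    define a where "a = Max A"
    have a: "a \<in> F" "a < x" using Max_A 2 by (simp_all add: a_def)
    have "f \<le> a" if "f \<in> F" for f
      using mem[OF that] 2 Max_ge[OF fin(1)] by (auto simp: a_def)
    moreover obtain f where "f \<in> F" "\<bar>1 - f\<bar> \<le> c" using net by (metis atLeastAtMost_iff order_refl zero_le_one)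
    moreover have "a \<le> 1" using a F by auto
    ultimately have "1 - a \<le> c" by fastforce
    then show ?thesis
    proof (intro goal[of "(a + x) / 2" 1])
      show "t \<in> {(a + x) / 2..1}" if "t \<in> {0..1}" "\<forall>f\<in>F. \<bar>t - x\<bar> \<le> \<bar>t - f\<bar>" for t
        using that lower[OF a(2)] a(1) by auto
      show "1 - (a + x) / 2 \<le> c" using \<open>1 - a \<le> c\<close> a(2) by (simp add: field_simps)
    qed (use x a in auto)
  next
    case 3
    define a b where "a = Max A" and "b = Min B"
    have a: "a \<in> F" "a < x" and b: "b \<in> F" "x < b"
      using Max_A Min_B 3 by (simp_all add: a_def b_def)
    \<comment> \<open>The customer in the middle of the gap is farthest from the rivals, so the net
      condition there bounds the gap.\<close>
    define u where "u = (a + b) / 2"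
    have u: "2 * u = a + b" by (simp add: u_def)
    then have "u \<in> {0..1}" using a b F by auto
    then obtain f where "f \<in> F" "\<bar>u - f\<bar> \<le> c" using net by blast
    then have "b - a \<le> 2 * c"
      using u gap[of f] by (auto simp: abs_if a_def b_def split: if_splits)
    then show ?thesis
    proof (intro goal[of "(a + x) / 2" "(x + b) / 2"])
      show "t \<in> {(a + x) / 2..(x + b) / 2}" if "\<forall>f\<in>F. \<bar>t - x\<bar> \<le> \<bar>t - f\<bar>" for t
        using that lower[OF a(2)] upper[OF b(2)] a(1) b(1) by auto
      show "(x + b) / 2 - (a + x) / 2 \<le> c" using \<open>b - a \<le> 2 * c\<close> by (simp add: field_simps)
    qed (use a b in auto)
  qed
qed

text \<open>The share is dominated by a sum of weighted indicators, one per facility, each of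
  integral at most \<open>c\<close>.\<close>

lemma payoff_le_of_net:
  assumes game: "multi_unit_game N n" and profile: "pure_profile N n s" and i: "i \<in> {1..N}" "2 \<le> N"
    and net: "\<forall>t\<in>{0..1}. \<exists>f\<in>rival_locations N s i. \<bar>t - f\<bar> \<le> c"
  shows "payoff N s i \<le> n i * c"
proof -
  define F X where "F = rival_locations N s i" and "X = set (s i)"
  note ne = pure_profile_nonempty[OF profile game]
  have X: "X \<subseteq> {0..1}" "card X = n i" "finite X"
    using pure_strategiesD[of "s i" "n i"] profile i by (auto simp: pure_profile_def X_def)
  have F: "finite F" "F \<subseteq> {0..1}"
    using rival_locations_props(1)[OF profile] by (auto simp: F_def)
  have "\<forall>x\<in>X. \<exists>a b w. a \<le> b \<and> w * (b - a) \<le> c \<and> w = (if x \<in> F then 1 / 2 else 1) \<and>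
    (\<forall>t\<in>{0..1}. (\<forall>f\<in>F. \<bar>t - x\<bar> \<le> \<bar>t - f\<bar>) \<longrightarrow> t \<in> {a..b})"
    using single_facility_bound[OF F] X net by (auto simp: F_def[symmetric] subset_iff)
  then obtain a b w where abw: "\<And>x. x \<in> X \<Longrightarrow> a x \<le> b x \<and> w x * (b x - a x) \<le> c \<and>
    w x = (if x \<in> F then 1 / 2 else 1) \<and>
    (\<forall>t\<in>{0..1}. (\<forall>f\<in>F. \<bar>t - x\<bar> \<le> \<bar>t - f\<bar>) \<longrightarrow> t \<in> {a x..b x})"
    unfolding bchoice_iff by (auto simp: Ball_def)
  define h where "h x t = w x * indicat_real {a x..b x} t" for x t
  have h_nonneg: "0 \<le> h x t" if "x \<in> X" for x t
    using abw[OF that] by (simp add: h_def)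
  have h_int: "h x integrable_on {0..1}" for x
    unfolding h_def by (intro integrable_on_mult_right) (simp add: integrable_on_indicator)
  have share_le: "share N s i t \<le> (\<Sum>x\<in>X. h x t)" if t: "t \<in> {0..1}" for t
  proof (cases "reaches F X t")
    case False
    then have "share N s i t = 0"
      using share_eq_0[OF ne i(1)] by (simp add: F_def X_def)
    then show ?thesis using h_nonneg by (simp add: sum_nonneg)
  next
    case True
    have le_sum: "h x t \<le> (\<Sum>x\<in>X. h x t)" if "x \<in> X" for x
      using that h_nonneg X by (intro member_le_sum) auto
    show ?thesis
    proof (cases "wins F X t")
      case True
      then obtain x where x: "x \<in> X" "\<forall>f\<in>F. \<bar>t - x\<bar> < \<bar>t - f\<bar>" by (auto simp: wins_def)
      then have "x \<notin> F" by blast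
      moreover have "t \<in> {a x..b x}" using abw[OF x(1)] t x(2) by (meson less_imp_le)
      ultimately have "h x t = 1" using abw[OF x(1)] by (simp add: h_def)
      then show ?thesis using le_sum[OF x(1)] share_le_1[of N s i t] by simp
    next
      case False
      obtain x where x: "x \<in> X" "\<forall>f\<in>F. \<bar>t - x\<bar> \<le> \<bar>t - f\<bar>" using True by (auto simp: reaches_def)
      then have "t \<in> {a x..b x}" using abw[OF x(1)] t by blast
      then have "1 / 2 \<le> h x t" using abw[OF x(1)] by (simp add: h_def)
      moreover have "share N s i t \<le> 1 / 2"
        using share_le_half[OF ne i] False by (simp add: F_def X_def)
      ultimately show ?thesis using le_sum[OF x(1)] by simp
    qed
  qed
  have "payoff N s i \<le> integral {0..1} (\<lambda>t. \<Sum>x\<in>X. h x t)"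
    unfolding payoff_eq_integral_share
    using share_integrable[OF ne i(1)] h_int share_le X by (intro integral_le integrable_sum) auto
  also have "\<dots> = (\<Sum>x\<in>X. integral {0..1} (h x))"
    using h_int X by (intro integral_sum) auto
  also have "\<dots> \<le> (\<Sum>x\<in>X. c)"
  proof (rule sum_mono)
    fix x
    assume x: "x \<in> X"
    have "integral {0..1} (h x) = w x * measure lebesgue ({a x..b x} \<inter> {0..1})"
      unfolding h_def by (simp add: integral_indicator)
    also have "\<dots> \<le> w x * measure lebesgue {a x..b x}"
      using abw[OF x] by (intro mult_left_mono measure_mono_fmeasurable) auto
    also have "\<dots> = w x * (b x - a x)" using abw[OF x] by simp
    also have "\<dots> \<le> c" using abw[OF x] by blast
    finally show "integral {0..1} (h x) \<le> c" .
  qed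
  finally show ?thesis using X by simp
qed

text \<open>The payoffs add up to 1, so the upper bounds for deviations are attained by the profile itself.\<close>

lemma Nash_of_nets:
  assumes game: "multi_unit_game N n" and profile: "pure_profile N n s" and N: "2 \<le> N"
    and net: "\<And>i t. i \<in> {1..N} \<Longrightarrow> t \<in> {0..1} \<Longrightarrow> \<exists>f\<in>rival_locations N s i. \<bar>t - f\<bar> \<le> c i"
    and total: "(\<Sum>i\<in>{1..N}. n i * c i) = 1"
  shows "pure_Nash_equilibrium N n s"
proof -
  have le: "payoff N s i \<le> n i * c i" if "i \<in> {1..N}" for i
    using payoff_le_of_net[OF game profile that N] net that by blast
  have "(\<Sum>i\<in>{1..N}. n i * c i - payoff N s i) = 0"
    using total sum_payoff_eq_1[OF pure_profile_nonempty[OF profile game]] N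
    by (simp add: sum_subtractf)
  then have eq: "payoff N s i = n i * c i" if "i \<in> {1..N}" for i
    using that le sum_nonneg_eq_0_iff[of "{1..N}" "\<lambda>i. n i * c i - payoff N s i"] by simp
  \<comment> \<open>The net condition for player \<open>i\<close> concerns rivals only, so it
    survives the deviation.\<close>
  have "payoff N (s(i := x)) i \<le> n i * c i" if "i \<in> {1..N}" "x \<in> pure_strategies (n i)" for i x
    using that net
    by (intro payoff_le_of_net[OF game pure_profile_fun_upd[OF profile] that(1) N]) auto
  then show ?thesis
    using profile eq by (auto simp: pure_Nash_equilibrium_def not_less)
qed

section \<open>Distributing facilities among owners and grid points\<close>

lemma ex_interval_partition:
  fixes w :: "'a \<Rightarrow> nat"
  assumes "finite A"
  shows "\<exists>I. (\<forall>i\<in>A. \<exists>a. I i = {a..<a + w i}) \<and> (\<Union>i\<in>A. I i) = {..<\<Sum>i\<in>A. w i}"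
  using assms
proof (induction A rule: finite_induct)
  case empty
  then show ?case by simp
next
  case (insert j A)
  then obtain I where I: "\<forall>i\<in>A. \<exists>a. I i = {a..<a + w i}" "(\<Union>i\<in>A. I i) = {..<\<Sum>i\<in>A. w i}"
    by blast
  define S where "S = (\<Sum>i\<in>A. w i)"
  define I' where "I' = I(j := {S..<S + w j})"
  have "(\<Union>i\<in>A. I' i) = {..<S}"
    using I(2) insert.hyps by (auto simp: I'_def S_def)
  then have "(\<Union>i\<in>insert j A. I' i) = {..<\<Sum>i\<in>insert j A. w i}"
    using insert.hyps by (auto simp: I'_def S_def)
  moreover have "\<forall>i\<in>insert j A. \<exists>a. I' i = {a..<a + w i}"
    using I(1) by (auto simp: I'_def)
  ultimately show ?case by blast
qed

text \<open>Lay the \<open>2P\<close> items out owner by owner and put item \<open>q\<close> into slot \<open>q mod P\<close>.\<close>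

lemma ex_pairing:
  fixes r :: "'a \<Rightarrow> nat"
  assumes A: "finite A" and total: "(\<Sum>i\<in>A. r i) = 2 * P" and r: "\<forall>i\<in>A. r i \<le> P"
  shows "\<exists>Y. (\<forall>i\<in>A. Y i \<subseteq> {..<P} \<and> card (Y i) = r i) \<and>
    (\<forall>l<P. \<exists>i\<in>A. \<exists>j\<in>A. i \<noteq> j \<and> l \<in> Y i \<and> l \<in> Y j)"
proof -
  obtain I where I: "\<forall>i\<in>A. \<exists>a. I i = {a..<a + r i}" "(\<Union>i\<in>A. I i) = {..<2 * P}"
    using ex_interval_partition[OF A, of r] total by auto
  define Y where "Y i = (\<lambda>q. q mod P) ` I i" for i
  \<comment> \<open>Items of one owner form a block of at most \<open>P\<close> consecutive numbers.
    Hence they go to different slots, and \<open>l\<close> and \<open>l + P\<close>, which share a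
    slot, have different owners.\<close>
  have close: "q' < q + P" if "i \<in> A" "q \<in> I i" "q' \<in> I i" for i q q'
    using I(1) r that by fastforce
  have "Y i \<subseteq> {..<P} \<and> card (Y i) = r i" if i: "i \<in> A" for i
  proof
    have "0 < P" if "q \<in> I i" for q using close[OF i that that] by simp
    then show "Y i \<subseteq> {..<P}" by (auto simp: Y_def)
    have "inj_on (\<lambda>q. q mod P) (I i)"
    proof (rule linorder_inj_onI')
      fix q q' assume q: "q \<in> I i" "q' \<in> I i" "q < q'"
      then have "0 < q' - q" "q' - q < P" using close[OF i q(1,2)] by auto
      then have "\<not> P dvd q' - q" by (simp add: nat_dvd_not_less)
      then show "q mod P \<noteq> q' mod P"
        using mod_eq_dvd_iff_nat[of q q' P] q(3) by simp
    qed
    then have "card (Y i) = card (I i)" unfolding Y_def by (rule card_image)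
    then show "card (Y i) = r i" using I(1) i by fastforce
  qed
  moreover have "\<exists>i\<in>A. \<exists>j\<in>A. i \<noteq> j \<and> l \<in> Y i \<and> l \<in> Y j" if l: "l < P" for l
  proof -
    have "l \<in> (\<Union>i\<in>A. I i)" "l + P \<in> (\<Union>i\<in>A. I i)" using I(2) l by auto
    then obtain i j where ij: "i \<in> A" "l \<in> I i" "j \<in> A" "l + P \<in> I j" by blast
    have "i \<noteq> j" using close[OF ij(1,2), of "l + P"] ij by auto
    moreover have "l \<in> Y i"
      unfolding Y_def using ij l by (intro image_eqI[of _ _ l]) auto
    moreover have "l \<in> Y j"
      unfolding Y_def using ij l by (intro image_eqI[of _ _ "l + P"]) auto
    ultimately show ?thesis using ij by blast
  qed
  ultimately show ?thesis by blast
qed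

text \<open>Greedy choice: each index takes as much of the remaining demand as its bound
  allows.\<close>

lemma ex_bounded_sum_eq:
  fixes b :: "'a \<Rightarrow> nat"
  assumes "finite A" "k \<le> (\<Sum>i\<in>A. b i)"
  shows "\<exists>r. (\<forall>i. r i \<le> b i) \<and> (\<Sum>i\<in>A. r i) = k"
  using assms
proof (induction A arbitrary: k rule: finite_induct)
  case empty
  then show ?case by (intro exI[of _ "\<lambda>_. 0"]) auto
next
  case (insert j A)
  define d where "d = min k (b j)"
  have "k - d \<le> (\<Sum>i\<in>A. b i)" using insert by (auto simp: d_def)
  then obtain r where r: "\<forall>i. r i \<le> b i" "(\<Sum>i\<in>A. r i) = k - d"
    using insert.IH by blast
  have "(\<Sum>i\<in>A. (r(j := d)) i) = k - d"
    using r(2) insert.hyps by (subst sum.cong[OF refl, of A _ r]) auto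
  then show ?case
    using r insert.hyps by (intro exI[of _ "r(j := d)"]) (auto simp: d_def)
qed

text \<open>The grid points are the centres of \<open>m\<close> adjacent cells of length
  \<open>2 * c\<close>, and \<open>l\<close> is the cell containing \<open>t\<close>.\<close>

lemma nearest_grid_point:
  fixes a c t :: real and m :: nat
  assumes "0 < c" "1 \<le> m" "a \<le> t" "t \<le> a + 2 * c * m"
  shows "\<exists>l<m. \<bar>t - (a + c * (2 * real l + 1))\<bar> \<le> c"
proof -
  define z where "z = (t - a) / (2 * c)"
  have z: "0 \<le> z" "z \<le> m" "t = a + 2 * c * z"
    using assms by (auto simp: z_def field_simps)
  \<comment> \<open>The minimum is for the right border, where the floor would give the nonexistent
    cell \<open>m\<close>.\<close>
  define l where "l = min (nat \<lfloor>z\<rfloor>) (m - 1)"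
  have "real l \<le> z" using z by (simp add: l_def; linarith)
  moreover have "z \<le> real l + 1"
  proof (cases "nat \<lfloor>z\<rfloor> \<le> m - 1")
    case True
    then show ?thesis using z by (simp add: l_def; linarith)
  next
    case False
    then show ?thesis using z assms(2) by (simp add: l_def of_nat_diff)
  qed
  ultimately have "\<bar>2 * z - (2 * real l + 1)\<bar> \<le> 1" by (simp add: abs_le_iff)
  then have "c * \<bar>2 * z - (2 * real l + 1)\<bar> \<le> c * 1" using assms(1) by (intro mult_left_mono) auto
  moreover have "t - (a + c * (2 * real l + 1)) = c * (2 * z - (2 * real l + 1))"
    using z by (simp add: algebra_simps)
  ultimately have "\<bar>t - (a + c * (2 * real l + 1))\<bar> \<le> c"
    using assms(1) by (simp add: abs_mult)
  moreover have "l < m" using assms(2) by (simp add: l_def)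
  ultimately show ?thesis by blast
qed

section \<open>Construction of equilibria\<close>

lemma ex_Nash_of_sets:
  fixes X :: "nat \<Rightarrow> real set" and c :: "nat \<Rightarrow> real"
  assumes game: "multi_unit_game N n" and N: "2 \<le> N"
    and X: "\<And>i. i \<in> {1..N} \<Longrightarrow> finite (X i) \<and> X i \<subseteq> {0..1} \<and> card (X i) = n i"
    and net: "\<And>i t. i \<in> {1..N} \<Longrightarrow> t \<in> {0..1} \<Longrightarrow> \<exists>j\<in>{1..N} - {i}. \<exists>f\<in>X j. \<bar>t - f\<bar> \<le> c i"
    and total: "(\<Sum>i\<in>{1..N}. n i * c i) = 1"
  shows "\<exists>s. pure_Nash_equilibrium N n s"
proof -
  define s where "s i = sorted_list_of_set (X i)" for i
  have "pure_profile N n s"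
    using X by (simp add: pure_profile_def s_def sorted_list_of_set_pure_strategy)
  moreover have "\<exists>f\<in>rival_locations N s i. \<bar>t - f\<bar> \<le> c i" if it: "i \<in> {1..N}" "t \<in> {0..1}" for i t
  proof -
    obtain j f where jf: "j \<in> {1..N} - {i}" "f \<in> X j" "\<bar>t - f\<bar> \<le> c i"
      using net[OF it] by blast
    moreover have "f \<in> rival_locations N s i"
      unfolding rival_locations_def s_def using jf X[of j] by (intro UN_I[of j]) auto
    ultimately show ?thesis by blast
  qed
  ultimately have "pure_Nash_equilibrium N n s"
    using Nash_of_nets[OF game _ N] total by blast
  then show ?thesis by blast
qed

text \<open>With two owners on each of the \<open>P\<close> points, removing any one player leaves
  the full grid as a net, so all prices equal half the spacing. The bound \<open>n i \<le> P\<close>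
  is what the pairing requires.\<close>

lemma ex_Nash_even:
  assumes game: "multi_unit_game N n" and N: "2 \<le> N"
    and total: "(\<Sum>i\<in>{1..N}. n i) = 2 * P" and le: "\<forall>i\<in>{1..N}. n i \<le> P"
  shows "\<exists>s. pure_Nash_equilibrium N n s"
proof -
  obtain Y where Y: "\<forall>i\<in>{1..N}. Y i \<subseteq> {..<P} \<and> card (Y i) = n i"
    "\<forall>l<P. \<exists>i\<in>{1..N}. \<exists>j\<in>{1..N}. i \<noteq> j \<and> l \<in> Y i \<and> l \<in> Y j"
    using ex_pairing[OF _ total le] by blast
  have "0 < n 1" "n 1 \<le> P" using game N le by (auto simp: multi_unit_game_def)
  then have P: "1 \<le> P" by simp
  define c where "c = 1 / (2 * real P)"
  have c: "0 < c" "2 * c * P = 1" using P by (auto simp: c_def)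
  \<comment> \<open>The summand 0 matches the form of \<open>nearest_grid_point\<close> with
    \<open>a = 0\<close>.\<close>
  define X where "X i = (\<lambda>l. 0 + c * (2 * real l + 1)) ` Y i" for i
  show ?thesis
  proof (rule ex_Nash_of_sets[OF game N, of X "\<lambda>_. c"])
    fix i
    assume i: "i \<in> {1..N}"
    have "inj_on (\<lambda>l. 0 + c * (2 * real l + 1)) (Y i)" using c by (auto simp: inj_on_def)
    then have "card (X i) = n i" using Y(1) i by (simp add: X_def card_image)
    moreover have "c * (2 * real l + 1) \<le> 1" if "l \<in> Y i" for l
    proof -
      have "l < P" using Y(1) i that by blast
      then have "c * (2 * real l + 1) \<le> c * (2 * real P)" using c by (intro mult_left_mono) auto
      also have "\<dots> = 1" using c(2) by (simp only: mult_ac)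
      finally show ?thesis .
    qed
    moreover have "finite (Y i)" using Y(1) i finite_subset by blast
    ultimately show "finite (X i) \<and> X i \<subseteq> {0..1} \<and> card (X i) = n i"
      using c by (auto simp: X_def)
  next
    fix i and t :: real
    assume i: "i \<in> {1..N}" and t: "t \<in> {0..1}"
    obtain l where l: "l < P" "\<bar>t - (0 + c * (2 * real l + 1))\<bar> \<le> c"
      using nearest_grid_point[of c P 0 t] c P t by auto
    obtain j where "j \<in> {1..N} - {i}" "l \<in> Y j"
      using Y(2) l(1) by blast
    then show "\<exists>j\<in>{1..N} - {i}. \<exists>f\<in>X j. \<bar>t - f\<bar> \<le> c"
      using l(2) unfolding X_def by blast
  next
    have "(\<Sum>i\<in>{1..N}. real (n i) * c) = real (\<Sum>i\<in>{1..N}. n i) * c"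
      by (simp add: sum_distrib_right)
    then show "(\<Sum>i\<in>{1..N}. real (n i) * c) = 1"
      using c(2) unfolding total by (simp add: mult_ac)
  qed
qed

text \<open>Two indices reaching the cap \<open>P\<close> suffice alone; if only one does, the
  hypothesis on it leaves at least \<open>P\<close> for the others; if none does, capping changes
  nothing.\<close>

lemma sum_min_ge:
  fixes w :: "'a \<Rightarrow> nat"
  assumes A: "finite A" and total: "2 * P \<le> (\<Sum>i\<in>A. w i)"
    and w: "\<And>i. i \<in> A \<Longrightarrow> P + w i \<le> (\<Sum>i\<in>A. w i)"
  shows "2 * P \<le> (\<Sum>i\<in>A. min (w i) P)"
proof (cases "\<exists>i\<in>A. P \<le> w i")
  case False
  then have "(\<Sum>i\<in>A. min (w i) P) = (\<Sum>i\<in>A. w i)" by (intro sum.cong) (force simp: min_def)+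
  then show ?thesis using total by simp
next
  case True
  then obtain i where i: "i \<in> A" "P \<le> w i" by blast
  have "P \<le> (\<Sum>j\<in>A - {i}. min (w j) P)"
  proof (cases "\<exists>j\<in>A - {i}. P \<le> w j")
    case True
    then obtain j where "j \<in> A - {i}" "P \<le> w j" by blast
    then show ?thesis using member_le_sum[of j "A - {i}" "\<lambda>j. min (w j) P"] A by simp
  next
    case False
    then have "(\<Sum>j\<in>A - {i}. min (w j) P) = (\<Sum>j\<in>A - {i}. w j)" by (intro sum.cong) (force simp: min_def)+
    then show ?thesis using w[OF i(1)] sum.remove[OF A i(1), of w] by simp
  qed
  then show ?thesis using sum.remove[OF A i(1), of "\<lambda>i. min (w i) P"] i by simp
qed

text \<open>The grid has \<open>P + n 1\<close> points. Those outside the block of player 1 take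
  \<open>2 * P\<close> facilities of the others, which leaves \<open>n 1 - 1\<close> to cut the
  block. \<open>2 \<le> P\<close> provides a paired point on either side of the block.\<close>

lemma ex_Nash_odd:
  assumes game: "multi_unit_game N n" and N: "2 \<le> N"
    and total: "(\<Sum>i\<in>{1..N}. n i) + 1 = 2 * P + 2 * n 1" and P: "2 \<le> P"
    and le: "\<And>i. i \<in> {1..N} \<Longrightarrow> n i + 1 \<le> P + n 1"
  shows "\<exists>s. pure_Nash_equilibrium N n s"
proof -
  define m where "m = n 1"
  have m: "1 \<le> m" using game N by (auto simp: m_def multi_unit_game_def Suc_le_eq)
  define A where "A = {2..N}"
  have players: "{1..N} = insert 1 A" "1 \<notin> A" "finite A" using N by (auto simp: A_def)
  have sumA: "(\<Sum>i\<in>A. n i) + 1 = 2 * P + m" using total players by (simp add: m_def)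
  have "2 * P \<le> (\<Sum>i\<in>A. min (n i) P)"
  proof (rule sum_min_ge[OF players(3)])
    show "2 * P \<le> sum n A" using sumA m by simp
    show "P + n i \<le> sum n A" if "i \<in> A" for i
    proof -
      have "i \<in> {1..N}" using that players by simp
      from le[OF this] sumA show ?thesis by (simp add: m_def)
    qed
  qed
  then obtain r where r: "\<And>i. r i \<le> min (n i) P" "(\<Sum>i\<in>A. r i) = 2 * P"
    using ex_bounded_sum_eq[OF players(3)] by blast
  obtain Y where Y: "\<forall>i\<in>A. Y i \<subseteq> {..<P} \<and> card (Y i) = r i"
    "\<forall>l<P. \<exists>i\<in>A. \<exists>j\<in>A. i \<noteq> j \<and> l \<in> Y i \<and> l \<in> Y j"
    using ex_pairing[OF players(3) r(2)] r(1) by auto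
  \<comment> \<open>\<open>r i\<close> facilities of player \<open>i\<close> go into pairs; the
    remaining ones become cutting points.\<close>
  have "(\<Sum>i\<in>A. n i - r i) = m - 1"
    using sumA r by (subst sum_subtractf_nat) auto
  then obtain I where I: "\<forall>i\<in>A. \<exists>a. I i = {a..<a + (n i - r i)}" "(\<Union>i\<in>A. I i) = {..<m - 1}"
    using ex_interval_partition[OF players(3), of "\<lambda>i. n i - r i"] by auto
  define e where "e = 1 / (2 * (real P + real m))"
  have e: "0 < e" "2 * e * (real P + real m) = 1" using P by (auto simp: e_def)
  \<comment> \<open>The paired points \<open>grid 0\<close> and \<open>grid (m + 1)\<close> around
    the block are \<open>2 * e * (m + 1)\<close> apart, so \<open>D\<close> is the length of one of
    \<open>m\<close> equal parts.\<close>
  define D where "D = 2 * e * (real m + 1) / real m"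
  have D: "D * m = 2 * e * (real m + 1)" "2 * e \<le> D"
    using m e by (auto simp: D_def field_simps)
  then have D_pos: "0 < D" using e by simp
  define grid where "grid l = 0 + e * (2 * real l + 1)" for l :: nat
  \<comment> \<open>Numbers the \<open>P\<close> grid points outside the block
    \<open>{1..m}\<close>: first 0, then those from \<open>m + 1\<close> on.\<close>
  define pair where "pair l = (if l = 0 then 0 else l + m)" for l :: nat
  define mid where "mid q = e + D * (real q + 1)" for q :: nat
  define X where "X i = (if i = 1 then grid ` {1..m} else grid ` pair ` Y i \<union> mid ` I i)" for i
  define c where "c i = (if i = 1 then D / 2 else e)" for i :: nat
  have grid_inj: "inj grid" using e by (auto simp: inj_on_def grid_def)
  have grid_mono: "l \<le> l' \<Longrightarrow> grid l \<le> grid l'" for l l' using e by (simp add: grid_def)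
  have grid_le_1: "grid l \<le> 1" if "l < P + m" for l
  proof -
    have "real (2 * l + 1) \<le> real (2 * (P + m))" using that by (intro of_nat_mono) simp
    then have "2 * real l + 1 \<le> 2 * (real P + real m)" by simp
    then have "grid l \<le> e * (2 * (real P + real m))"
      unfolding grid_def add_0 using e by (intro mult_left_mono) simp_all
    also have "\<dots> = 1" using e(2) by (simp only: mult_ac)
    finally show ?thesis .
  qed
  have grid_nonneg: "0 \<le> grid l" for l using e by (simp add: grid_def)
  have last: "e + D * m = grid (m + 1)" unfolding D(1) by (simp add: grid_def algebra_simps)
  have mid_bounds: "grid 0 < mid q" "mid q < grid (m + 1)" if "q < m - 1" for q
  proof -
    show "grid 0 < mid q" using D D_pos by (simp add: grid_def mid_def)
    have "D * (real q + 1) < D * m" using D D_pos that by (intro mult_strict_left_mono) auto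
    then show "mid q < grid (m + 1)" unfolding last[symmetric] by (simp add: mid_def)
  qed
  have pair_inj: "inj pair" by (auto simp: inj_def pair_def split: if_splits)
  have pair_cover: "\<exists>j\<in>A - {i}. grid l \<in> X j" if "l = 0 \<or> m < l" "l < P + m" for i l
  proof -
    define l' where "l' = (if l = 0 then 0 else l - m)"
    have l': "l = pair l'" "l' < P" using that P by (auto simp: l'_def pair_def)
    then obtain j where j: "j \<in> A - {i}" "l' \<in> Y j" using Y(2) by blast
    then have "j \<noteq> 1" using players by blast
    then have "grid l \<in> X j" using j l' by (simp add: X_def)
    then show ?thesis using j by blast
  qed
  have near: "\<exists>l<P + m. \<bar>t - grid l\<bar> \<le> e" if "t \<in> {0..1}" for t
    using nearest_grid_point[of e "P + m" 0 t] e P that by (auto simp: grid_def)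
  show ?thesis
  proof (rule ex_Nash_of_sets[OF game N, of X c])
    fix i
    assume i: "i \<in> {1..N}"
    show "finite (X i) \<and> X i \<subseteq> {0..1} \<and> card (X i) = n i"
    proof (cases "i = 1")
      case True
      then show ?thesis
        using grid_inj grid_nonneg P by (auto simp: X_def m_def card_image inj_on_subset intro!: grid_le_1)
    next
      case False
      then have iA: "i \<in> A" using i unfolding players(1) by simp
      obtain a where a: "I i = {a..<a + (n i - r i)}" using I(1) iA by blast
      have fin: "finite (Y i)" "finite (I i)"
        using Y(1) iA finite_subset[of "Y i" "{..<P}"] a by auto
      have Il: "q < m - 1" if "q \<in> I i" for q using I(2) iA that by blast
      have pair_outside: "grid (pair l) \<le> grid 0 \<or> grid (m + 1) \<le> grid (pair l)" for l
        by (cases "l = 0") (auto simp: pair_def intro!: grid_mono)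
      have "grid (pair l) \<noteq> mid q" if "q \<in> I i" for l q
        using mid_bounds[OF Il[OF that]] pair_outside[of l] by linarith
      then have disj: "grid ` pair ` Y i \<inter> mid ` I i = {}" by blast
      have "card (grid ` pair ` Y i) = r i"
        using Y(1) iA grid_inj pair_inj by (simp add: card_image inj_on_subset)
      moreover have "card (mid ` I i) = n i - r i"
      proof -
        have "inj_on mid (I i)" using D_pos by (auto simp: inj_on_def mid_def)
        then show ?thesis using a by (simp add: card_image)
      qed
      ultimately have "card (X i) = n i"
        using False disj fin r(1)[of i] by (simp add: X_def card_Un_disjoint)
      moreover have "grid (pair l) \<le> 1" if "l \<in> Y i" for l
      proof -
        have "l < P" using Y(1) iA that by blast
        then show ?thesis using P by (intro grid_le_1) (auto simp: pair_def)
      qed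
      moreover have "0 \<le> mid q \<and> mid q \<le> 1" if "q \<in> I i" for q
        using mid_bounds[OF Il[OF that]] grid_nonneg[of 0] grid_le_1[of "m + 1"] P by auto
      ultimately show ?thesis using False fin grid_nonneg by (auto simp: X_def)
    qed
  next
    fix i and t :: real
    assume i: "i \<in> {1..N}" and t: "t \<in> {0..1}"
    obtain l where l: "l < P + m" "\<bar>t - grid l\<bar> \<le> e" using near[OF t] by blast
    have ec: "e \<le> c i" using D D_pos by (simp add: c_def)
    show "\<exists>j\<in>{1..N} - {i}. \<exists>f\<in>X j. \<bar>t - f\<bar> \<le> c i"
    proof (cases "l = 0 \<or> m < l")
      case True
      then obtain j where "j \<in> A - {i}" "grid l \<in> X j" using pair_cover l by blast
      then show ?thesis using l ec unfolding players(1) by (intro bexI[of _ j] bexI[of _ "grid l"]) auto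
    next
      case inner: False
      then have lm: "1 \<le> l" "l \<le> m" by auto
      show ?thesis
      proof (cases "i = 1")
        case False
        then show ?thesis
          using lm l ec False unfolding players(1) by (intro bexI[of _ 1] bexI[of _ "grid l"]) (auto simp: X_def)
      next
        case i1: True
        have "grid 1 - e \<le> t" "t \<le> grid m + e"
          using l grid_mono[OF lm(1)] grid_mono[OF lm(2)] by auto
        then have "e \<le> t" "t \<le> e + D * m" using e unfolding last by (auto simp: grid_def algebra_simps)
        \<comment> \<open>The points \<open>e + D * j\<close> with \<open>j \<le> m\<close> are the
          cutting points together with both paired ends. They are centres of \<open>m + 1\<close>
          cells of length \<open>D\<close>, so the first cell starts at
          \<open>e - D / 2\<close>.\<close>
        then have "\<exists>j<m + 1. \<bar>t - (e - D / 2 + D / 2 * (2 * real j + 1))\<bar> \<le> D / 2"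
          using D D_pos by (intro nearest_grid_point) (auto simp: algebra_simps)
        then obtain j where j: "j \<le> m" "\<bar>t - (e + D * j)\<bar> \<le> D / 2"
          by (auto simp: algebra_simps less_Suc_eq_le)
        have "\<exists>i\<in>A. e + D * j \<in> X i"
        proof -
          consider "j = 0" | "j = m" | "1 \<le> j" "j < m" using j by linarith
          then show ?thesis
          proof cases
            case 1
            then show ?thesis using pair_cover[of 0 1] P by (auto simp: grid_def)
          next
            case 2
            then show ?thesis using pair_cover[of "m + 1" 1] P last by auto
          next
            case 3
            then have "j - 1 \<in> (\<Union>i\<in>A. I i)" using I(2) by auto
            then obtain i where i: "i \<in> A" "j - 1 \<in> I i" by blast
            then have "i \<noteq> 1" using players by blast
            then have "mid (j - 1) \<in> X i" using i by (simp add: X_def)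
            moreover have "mid (j - 1) = e + D * j" using 3 by (simp add: mid_def of_nat_diff)
            ultimately show ?thesis using i by force
          qed
        qed
        then obtain i' where "i' \<in> A" "e + D * j \<in> X i'" by blast
        then show ?thesis
          using i1 j players(2) unfolding players(1) by (intro bexI[of _ i'] bexI[of _ "e + D * j"]) (auto simp: c_def)
      qed
    qed
  next
    have "(\<Sum>i\<in>{1..N}. n i * c i) = m * (D / 2) + (\<Sum>i\<in>A. n i * e)"
    proof -
      have "(\<Sum>i\<in>A. n i * c i) = (\<Sum>i\<in>A. n i * e)"
        using players(2) by (intro sum.cong refl) (auto simp: c_def)
      then show ?thesis
        unfolding players(1) using players(2,3) by (simp add: c_def m_def)
    qed
    also have "(\<Sum>i\<in>A. n i * e) = real (\<Sum>i\<in>A. n i) * e" by (simp add: sum_distrib_right)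
    also have "real (\<Sum>i\<in>A. n i) = 2 * real P + real m - 1" using sumA by linarith
    \<comment> \<open>Player 1 contributes \<open>e * (m + 1)\<close>, so the total is
      \<open>2 * e * (P + m)\<close>.\<close>
    also have "m * (D / 2) + (2 * real P + real m - 1) * e = 1"
      using D(1) e(2) by (simp add: field_simps)
    finally show "(\<Sum>i\<in>{1..N}. n i * c i) = 1" .
  qed
qed

theorem theorem5:
  fixes N :: nat and n :: "nat \<Rightarrow> nat"
  assumes "multi_unit_game N n"
    and "N \<ge> 3"
    and "(\<Sum>i=1..N. n i) \<ge> 4"
  shows "(\<exists>s. pure_Nash_equilibrium N n s) \<longleftrightarrow> \<not> has_dominant_player N n"
proof
  show "\<exists>s. pure_Nash_equilibrium N n s \<Longrightarrow> \<not> has_dominant_player N n"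
    using no_Nash_if_dominant assms(1,2) by auto
next
  assume no_dom: "\<not> has_dominant_player N n"
  have N: "2 \<le> N" using assms(2) by simp
  define T where "T = (\<Sum>i=1..N. n i)"
  have "{1..N} = insert N {1..N - 1}" using N by auto
  then have "T = n N + (\<Sum>i=1..N - 1. n i)" using N by (simp add: T_def)
  then have nN: "2 * n N \<le> T" using no_dom by (simp add: has_dominant_player_def)
  have mono: "i \<in> {1..N} \<Longrightarrow> j \<in> {1..N} \<Longrightarrow> i \<le> j \<Longrightarrow> n i \<le> n j" for i j
    using assms(1) by (auto simp: multi_unit_game_def mono_on_def)
  have le_nN: "i \<in> {1..N} \<Longrightarrow> n i \<le> n N" for i using mono N by auto
  show "\<exists>s. pure_Nash_equilibrium N n s"
  proof (cases "even T")
    case True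
    then obtain P where "T = 2 * P" by blast
    then show ?thesis
      using ex_Nash_even[OF assms(1) N, of P] nN le_nN by (force simp: T_def)
  next
    case odd: False
    have "(\<Sum>i=1..N. n 1) \<le> T" unfolding T_def using mono N by (intro sum_mono) auto
    then have "N * n 1 \<le> T" by simp
    moreover have "3 * n 1 \<le> N * n 1" using assms(2) by (rule mult_le_mono1)
    ultimately have "3 * n 1 \<le> T" by (rule order_trans[rotated])
    moreover obtain k where k: "T = 2 * k + 1" using odd by (elim oddE)
    moreover have "0 < n 1" using assms(1) N by (auto simp: multi_unit_game_def)
    moreover have "4 \<le> T" using assms(3) by (simp add: T_def)
    \<comment> \<open>Having at least three players limits the smallest to a third of
      \<open>T\<close>; an odd \<open>T \<ge> 4\<close> is at least 5, which forces
      \<open>n 1 < k\<close>.\<close>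
    ultimately have P: "2 \<le> k + 1 - n 1" "n 1 \<le> k" by presburger+
    show ?thesis
    proof (rule ex_Nash_odd[OF assms(1) N _ P(1)])
      show "(\<Sum>i=1..N. n i) + 1 = 2 * (k + 1 - n 1) + 2 * n 1"
        using k P by (simp add: T_def)
      \<comment> \<open>Without a dominant player \<open>2 * n N \<le> 2 * k + 1\<close>, and by
        parity \<open>n N \<le> k\<close>.\<close>
      show "n i + 1 \<le> k + 1 - n 1 + n 1" if "i \<in> {1..N}" for i
        using le_nN[OF that] nN k P by simp
    qed
  qed
qed

end
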